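(* For any matroid $\mathcal{M}$ of rank $k$ and any $\epsilon>0$, there is a combinatorial algorithm for dynamic monotone submodular maximization under the matroid constraint $\mathcal{M}$ over insertion-only streams that maintains, after every insertion, a feasible set $S$ that is a $(1/2-\epsilon)$-approximate solution, with amortized number of queries per update $k^{\tilde{O}(1/\epsilon)}$.
   Context: A matroid $\mathcal{M}\subseteq 2^V$ contains $\emptyset$, is downward closed and has the augmentation property; its rank $k$ is the maximum size of a member; feasible means $S\in\mathcal{M}$. The algorithm has query access to a nonnegative monotone submodular $f:2^V\to\mathbb{R}$ and membership queries to $\mathcal{M}$. Insertion-only stream: $V_0=\emptyset$, in round $i$ element $e_i$ is inserted, $V_i=V_{i-1}\cup\{e_i\}$, and the algorithm must output $S_i\subseteq V_i$, $S_i\in\mathcal{M}$; it is $\gamma$-approximate if $f(S_i)\ge\gamma\max_{T\in\mathcal{M},T\subseteq V_i}f(T)$. Amortized queries per update counts queries to both $f$ and $\mathcal{M}$ divided by the number of rounds. *)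

theory Defs
  imports "HOL-Library.Landau_Symbols" Complex_Main
begin

definition matroid :: "'a set \<Rightarrow> 'a set set \<Rightarrow> bool" where
  "matroid V M \<longleftrightarrow>
     finite V \<and> M \<subseteq> Pow V \<and> {} \<in> M \<and>
     (\<forall>S\<in>M. \<forall>T. T \<subseteq> S \<longrightarrow> T \<in> M) \<and>
     (\<forall>S\<in>M. \<forall>T\<in>M. card S < card T \<longrightarrow> (\<exists>x\<in>T - S. insert x S \<in> M))"

definition matroid_rank :: "'a set set \<Rightarrow> nat" where
  "matroid_rank M = Max (card ` M)"

definition submodular_on :: "'a set \<Rightarrow> ('a set \<Rightarrow> real) \<Rightarrow> bool" where
  "submodular_on V f \<longleftrightarrow>
     (\<forall>A B. A \<subseteq> V \<longrightarrow> B \<subseteq> V \<longrightarrow> f (A \<union> B) + f (A \<inter> B) \<le> f A + f B)"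

definition nonneg_monotone_submodular :: "'a set \<Rightarrow> ('a set \<Rightarrow> real) \<Rightarrow> bool" where
  "nonneg_monotone_submodular V f \<longleftrightarrow>
     (\<forall>A\<subseteq>V. 0 \<le> f A) \<and> mono_on (Pow V) f \<and> submodular_on V f"

(* A deterministic adaptive computation with access to a value oracle and a membership oracle:
   a well-founded decision tree that branches on the answers. Only queries are accounted for. *)
datatype ('a, 'r) query_program =
    Return 'r
  | Query_Value "'a set" "real \<Rightarrow> ('a, 'r) query_program"
  | Query_Member "'a set" "bool \<Rightarrow> ('a, 'r) query_program"

primrec result :: "('a set \<Rightarrow> real) \<Rightarrow> 'a set set \<Rightarrow> ('a, 'r) query_program \<Rightarrow> 'r" where
  "result f M (Return r) = r"
| "result f M (Query_Value A p) = result f M (p (f A))"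
| "result f M (Query_Member A p) = result f M (p (A \<in> M))"

(* The arguments of all oracle calls in order; repeated calls are listed, hence counted, repeatedly. *)
primrec queries :: "('a set \<Rightarrow> real) \<Rightarrow> 'a set set \<Rightarrow> ('a, 'r) query_program \<Rightarrow> 'a set list" where
  "queries f M (Return r) = []"
| "queries f M (Query_Value A p) = A # queries f M (p (f A))"
| "queries f M (Query_Member A p) = A # queries f M (p (A \<in> M))"

(* An online algorithm reacts to an inserted element by a query program that returns the
   solution output in this round together with the algorithm to be used from the next round on,
   so the latter plays the role of an unrestricted internal state. *)
codatatype 'a online_algorithm =
  Online (on_insert: "'a \<Rightarrow> ('a, 'a set \<times> 'a online_algorithm) query_program")

(* For each round of an insertion-only stream, the output and the queries made in that round. *)
fun run :: "('a set \<Rightarrow> real) \<Rightarrow> 'a set set \<Rightarrow> 'a online_algorithm \<Rightarrow> 'a list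
    \<Rightarrow> ('a set \<times> 'a set list) list" where
  "run f M Alg [] = []"
| "run f M Alg (e # es) =
     (let p = on_insert Alg e; (S, Alg') = result f M p
      in (S, queries f M p) # run f M Alg' es)"

(* Round i is list position i - 1, so the ground set after round i is the set of the first i
   entries of the stream. *)
definition ground :: "'a list \<Rightarrow> nat \<Rightarrow> 'a set" where
  "ground es i = set (take i es)"

definition solution :: "('a set \<Rightarrow> real) \<Rightarrow> 'a set set \<Rightarrow> 'a online_algorithm \<Rightarrow> 'a list
    \<Rightarrow> nat \<Rightarrow> 'a set" where
  "solution f M Alg es i = fst (run f M Alg es ! (i - 1))"

definition round_queries :: "('a set \<Rightarrow> real) \<Rightarrow> 'a set set \<Rightarrow> 'a online_algorithm \<Rightarrow> 'a list
    \<Rightarrow> nat \<Rightarrow> 'a set list" where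
  "round_queries f M Alg es i = snd (run f M Alg es ! (i - 1))"

definition amortized_queries :: "('a set \<Rightarrow> real) \<Rightarrow> 'a set set \<Rightarrow> 'a online_algorithm \<Rightarrow> 'a list
    \<Rightarrow> nat \<Rightarrow> real" where
  "amortized_queries f M Alg es i =
     real (\<Sum>j=1..i. length (round_queries f M Alg es j)) / real i"

definition approximate_solution :: "real \<Rightarrow> ('a set \<Rightarrow> real) \<Rightarrow> 'a set set \<Rightarrow> 'a set \<Rightarrow> 'a set \<Rightarrow> bool" where
  "approximate_solution \<gamma> f M U S \<longleftrightarrow> f S \<ge> \<gamma> * Max (f ` {T \<in> M. T \<subseteq> U})"

(* O-tilde of g, meant for g tending to infinity along F. *)
definition soft_bigo :: "'b filter \<Rightarrow> ('b \<Rightarrow> real) \<Rightarrow> ('b \<Rightarrow> real) set" where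
  "soft_bigo F g = (\<Union>c::nat. O[F](\<lambda>x. g x * ln (g x) ^ c))"

end

theory Submission
  imports Defs
begin

text \<open>
  Fix a guess \<open>W\<close> of the optimum up to a factor 2 and run greedy in \<open>L = O(log(k/\<eta>)/\<eta>)\<close> stages with
  thresholds \<open>W (1 - \<eta>)^j\<close>, each stage scanning the elements in order of arrival. A stage must be closed
  before the next one can start, although later arrivals might still qualify for it. So one also
  guesses, in units of \<open>\<delta> = \<eta> W / L\<close>, the gain \<open>g\<^sub>j\<close> that stage \<open>j\<close> will have collected by the current
  round, and closes the stage when this gain is reached. A guess that is right up to rounding loses at
  most \<open>\<delta>\<close> per stage, hence \<open>\<eta> W\<close> in total, and otherwise the exchange argument for greedy gives 1/2.
  Since \<open>\<Sum> g\<^sub>j \<le> L / \<eta>\<close>, there are only \<open>O(1/\<eta>)^L\<close> guesses, which is \<open>k\<close> to the power \<open>O(log\<^sup>2(1/\<eta>)/\<eta>)\<close>.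
  An element takes part only for those \<open>W\<close> that are comparable, up to a factor \<open>k/\<eta>\<close>, to its own value;
  this makes the number of queries per element independent of the length of the stream.
\<close>

section \<open>Query programs and memoization\<close>

primrec bind_program ::
  "('a, 'r) query_program \<Rightarrow> ('r \<Rightarrow> ('a, 's) query_program) \<Rightarrow> ('a, 's) query_program" where
  "bind_program (Return r) h = h r"
| "bind_program (Query_Value A p) h = Query_Value A (\<lambda>y. bind_program (p y) h)"
| "bind_program (Query_Member A p) h = Query_Member A (\<lambda>b. bind_program (p b) h)"

lemma result_bind [simp]:
  "result f M (bind_program p h) = result f M (h (result f M p))"
  by (induction p) auto

lemma queries_bind [simp]:
  "queries f M (bind_program p h) = queries f M p @ queries f M (h (result f M p))"
  by (induction p) auto

lemma result_map [simp]: "result f M (map_query_program h p) = h (result f M p)"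
  by (induction p) auto

lemma queries_map [simp]: "queries f M (map_query_program h p) = queries f M p"
  by (induction p) auto

primrec map_program ::
  "('b \<Rightarrow> ('a, 'r) query_program) \<Rightarrow> 'b list \<Rightarrow> ('a, 'r list) query_program" where
  "map_program h [] = Return []"
| "map_program h (x # xs) =
     bind_program (h x) (\<lambda>r. bind_program (map_program h xs) (\<lambda>rs. Return (r # rs)))"

lemma result_map_program [simp]:
  "result f M (map_program h xs) = map (\<lambda>x. result f M (h x)) xs"
  by (induction xs) auto

lemma queries_map_program [simp]:
  "queries f M (map_program h xs) = concat (map (\<lambda>x. queries f M (h x)) xs)"
  by (induction xs) auto

text \<open>Both oracles are asked whatever the membership answer is, so a call costs exactly two
  queries and its list of arguments does not branch.\<close>

definition ask :: "'a set \<Rightarrow> (bool \<Rightarrow> real \<Rightarrow> ('a, 'r) query_program) \<Rightarrow> ('a, 'r) query_program" where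
  "ask A h = Query_Member A (\<lambda>b. Query_Value A (h b))"

lemma result_ask [simp]: "result f M (ask A h) = result f M (h (A \<in> M) (f A))"
  by (simp add: ask_def)

lemma queries_ask [simp]: "queries f M (ask A h) = A # A # queries f M (h (A \<in> M) (f A))"
  by (simp add: ask_def)

primrec memo :: "('a, 'r) query_program \<Rightarrow> ('a set \<rightharpoonup> real) \<Rightarrow> ('a set \<rightharpoonup> bool)
    \<Rightarrow> ('a, 'r \<times> ('a set \<rightharpoonup> real) \<times> ('a set \<rightharpoonup> bool)) query_program" where
  "memo (Return r) = (\<lambda>cv cm. Return (r, cv, cm))"
| "memo (Query_Value A p) = (\<lambda>cv cm. case cv A of
     Some y \<Rightarrow> memo (p y) cv cm
   | None \<Rightarrow> Query_Value A (\<lambda>y. memo (p y) (cv(A \<mapsto> y)) cm))"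
| "memo (Query_Member A p) = (\<lambda>cv cm. case cm A of
     Some b \<Rightarrow> memo (p b) cv cm
   | None \<Rightarrow> Query_Member A (\<lambda>b. memo (p b) cv (cm(A \<mapsto> b))))"

definition valid_cache ::
  "('a set \<Rightarrow> real) \<Rightarrow> 'a set set \<Rightarrow> ('a set \<rightharpoonup> real) \<Rightarrow> ('a set \<rightharpoonup> bool) \<Rightarrow> bool" where
  "valid_cache f M cv cm \<longleftrightarrow> finite (dom cv) \<and> finite (dom cm) \<and>
     (\<forall>A y. cv A = Some y \<longrightarrow> y = f A) \<and> (\<forall>A b. cm A = Some b \<longrightarrow> b = (A \<in> M))"

text \<open>The last equation is the accounting: every query really made adds exactly one set to
  exactly one of the two caches. Over successive rounds it telescopes.\<close>

definition memo_result where
  "memo_result f M p cv cm cv' cm' \<longleftrightarrow>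
    result f M (memo p cv cm) = (result f M p, cv', cm') \<and> valid_cache f M cv' cm' \<and>
    set (queries f M (memo p cv cm)) \<subseteq> set (queries f M p) \<and>
    dom cv' \<subseteq> dom cv \<union> set (queries f M p) \<and> dom cm' \<subseteq> dom cm \<union> set (queries f M p) \<and>
    length (queries f M (memo p cv cm)) + card (dom cv) + card (dom cm) = card (dom cv') + card (dom cm')"

lemma memo_correct:
  assumes "valid_cache f M cv cm"
  shows "\<exists>cv' cm'. memo_result f M p cv cm cv' cm'"
  using assms
proof (induction p arbitrary: cv cm)
  case (Return r)
  then show ?case by (auto simp: memo_result_def)
next
  case (Query_Value A p)
  show ?case
  proof (cases "cv A")
    case None
    have *: "valid_cache f M (cv(A \<mapsto> f A)) cm" and fin: "finite (dom cv)"
      using Query_Value.prems by (auto simp: valid_cache_def)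
    obtain cv' cm' where r: "memo_result f M (p (f A)) (cv(A \<mapsto> f A)) cm cv' cm'"
      using Query_Value.IH[OF rangeI *] by blast
    have "card (insert A (dom cv)) = Suc (card (dom cv))"
      using None fin by (simp add: domIff)
    then have "memo_result f M (Query_Value A p) cv cm cv' cm'"
      using r None by (auto simp: memo_result_def simp del: domIff)
    then show ?thesis by blast
  next
    case (Some y)
    then have y: "y = f A" using Query_Value.prems by (auto simp: valid_cache_def)
    obtain cv' cm' where "memo_result f M (p (f A)) cv cm cv' cm'"
      using Query_Value.IH[OF rangeI Query_Value.prems] by blast
    then have "memo_result f M (Query_Value A p) cv cm cv' cm'"
      using Some y by (auto simp: memo_result_def simp del: domIff)
    then show ?thesis by blast
  qed
next
  case (Query_Member A p)
  show ?case
  proof (cases "cm A")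
    case None
    have *: "valid_cache f M cv (cm(A \<mapsto> (A \<in> M)))" and fin: "finite (dom cm)"
      using Query_Member.prems by (auto simp: valid_cache_def)
    obtain cv' cm' where r: "memo_result f M (p (A \<in> M)) cv (cm(A \<mapsto> (A \<in> M))) cv' cm'"
      using Query_Member.IH[OF rangeI *] by blast
    have "card (insert A (dom cm)) = Suc (card (dom cm))"
      using None fin by (simp add: domIff)
    then have "memo_result f M (Query_Member A p) cv cm cv' cm'"
      using r None by (auto simp: memo_result_def simp del: domIff)
    then show ?thesis by blast
  next
    case (Some b)
    then have b: "b = (A \<in> M)" using Query_Member.prems by (auto simp: valid_cache_def)
    obtain cv' cm' where "memo_result f M (p (A \<in> M)) cv cm cv' cm'"
      using Query_Member.IH[OF rangeI Query_Member.prems] by blast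
    then have "memo_result f M (Query_Member A p) cv cm cv' cm'"
      using Some b by (auto simp: memo_result_def simp del: domIff)
    then show ?thesis by blast
  qed
qed

text \<open>The offline program is rerun from scratch on every prefix, but with all earlier answers cached, so
  only the number of distinct queries over all prefixes matters.\<close>

primcorec memo_alg :: "('a list \<Rightarrow> ('a, 'a set) query_program) \<Rightarrow> 'a list
    \<Rightarrow> ('a set \<rightharpoonup> real) \<Rightarrow> ('a set \<rightharpoonup> bool) \<Rightarrow> 'a online_algorithm" where
  "memo_alg P xs cv cm = Online (\<lambda>e. map_query_program
     (map_prod id (\<lambda>(cv', cm'). memo_alg P (xs @ [e]) cv' cm')) (memo (P (xs @ [e])) cv cm))"

text \<open>The accounting of \<open>memo_result\<close> telescopes, and both caches stay inside
  \<open>Q\<close>; the factor 2 stands for the two oracles. The induction peels off the front of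
  the stream, so the prefix already read and the caches must be arbitrary.\<close>

lemma run_memo_alg:
  assumes "valid_cache f M cv cm" "finite Q" "dom cv \<subseteq> Q" "dom cm \<subseteq> Q" "i < length es"
    and "\<And>j. j \<le> i \<Longrightarrow> set (queries f M (P (xs @ take (Suc j) es))) \<subseteq> Q"
  shows "fst (run f M (memo_alg P xs cv cm) es ! i) = result f M (P (xs @ take (Suc i) es)) \<and>
    set (snd (run f M (memo_alg P xs cv cm) es ! i)) \<subseteq> set (queries f M (P (xs @ take (Suc i) es))) \<and>
    (\<Sum>j\<le>i. length (snd (run f M (memo_alg P xs cv cm) es ! j))) + card (dom cv) + card (dom cm)
      \<le> 2 * card Q"
  using assms
proof (induction es arbitrary: xs cv cm i)
  case Nil
  then show ?case by simp
next
  case (Cons e es)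
  obtain cv' cm' where m: "result f M (memo (P (xs @ [e])) cv cm) = (result f M (P (xs @ [e])), cv', cm')"
    "valid_cache f M cv' cm'"
    "set (queries f M (memo (P (xs @ [e])) cv cm)) \<subseteq> set (queries f M (P (xs @ [e])))"
    "dom cv' \<subseteq> dom cv \<union> set (queries f M (P (xs @ [e])))"
    "dom cm' \<subseteq> dom cm \<union> set (queries f M (P (xs @ [e])))"
    "length (queries f M (memo (P (xs @ [e])) cv cm)) + card (dom cv) + card (dom cm)
      = card (dom cv') + card (dom cm')"
    using memo_correct[OF Cons.prems(1), of "P (xs @ [e])"] unfolding memo_result_def by blast
  have run: "run f M (memo_alg P xs cv cm) (e # es) =
    (result f M (P (xs @ [e])), queries f M (memo (P (xs @ [e])) cv cm))
      # run f M (memo_alg P (xs @ [e]) cv' cm') es"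
    by (simp add: m(1) Let_def)
  have Q: "set (queries f M (P (xs @ [e]))) \<subseteq> Q" using Cons.prems(6)[of 0] by simp
  have doms: "dom cv' \<subseteq> Q" "dom cm' \<subseteq> Q" using m(4,5) Q Cons.prems(3,4) by blast+
  show ?case
  proof (cases i)
    case 0
    have "card (dom cv') \<le> card Q" "card (dom cm') \<le> card Q"
      using doms Cons.prems(2) by (auto intro: card_mono)
    then show ?thesis unfolding run using 0 m by auto
  next
    case (Suc i')
    have Q': "\<And>j. j \<le> i' \<Longrightarrow> set (queries f M (P ((xs @ [e]) @ take (Suc j) es))) \<subseteq> Q"
      using Cons.prems(6)[of "Suc j" for j] Suc by simp
    have "i' < length es" using Cons.prems(5) Suc by simp
    from Cons.IH[OF m(2) Cons.prems(2) doms this, of "xs @ [e]", OF Q']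
    show ?thesis unfolding run Suc sum.atMost_Suc_shift using m(6) by simp
  qed
qed

lemma online_of_offline:
  fixes P :: "'a list \<Rightarrow> ('a, 'a set) query_program"
  assumes "finite Q" "i \<in> {1..length es}"
    and "\<And>j. j \<le> i \<Longrightarrow> set (queries f M (P (take j es))) \<subseteq> Q"
  defines "Alg \<equiv> memo_alg P [] Map.empty Map.empty"
  shows "solution f M Alg es i = result f M (P (take i es))"
    and "set (round_queries f M Alg es i) \<subseteq> set (queries f M (P (take i es)))"
    and "amortized_queries f M Alg es i \<le> 2 * real (card Q) / real i"
proof -
  obtain i' where i: "i = Suc i'" using assms(2) by (cases i) auto
  have v: "valid_cache f M Map.empty Map.empty" by (simp add: valid_cache_def)
  have r: "fst (run f M Alg es ! i') = result f M (P ([] @ take (Suc i') es)) \<and>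
    set (snd (run f M Alg es ! i')) \<subseteq> set (queries f M (P ([] @ take (Suc i') es))) \<and>
    (\<Sum>j\<le>i'. length (snd (run f M Alg es ! j))) + card (dom (Map.empty :: 'a set \<rightharpoonup> real))
      + card (dom (Map.empty :: 'a set \<rightharpoonup> bool)) \<le> 2 * card Q"
    unfolding Alg_def
    by (rule run_memo_alg[OF v assms(1)]) (use assms i in auto)
  show "solution f M Alg es i = result f M (P (take i es))"
    "set (round_queries f M Alg es i) \<subseteq> set (queries f M (P (take i es)))"
    using r by (auto simp: solution_def round_queries_def i)
  have "(\<Sum>j=1..i. length (round_queries f M Alg es j)) = (\<Sum>j\<le>i'. length (snd (run f M Alg es ! j)))"
    unfolding i round_queries_def
    by (rule sum.reindex_bij_witness[of _ Suc "\<lambda>j. j - 1"]) auto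
  then have "(\<Sum>j=1..i. length (round_queries f M Alg es j)) \<le> 2 * card Q" using r by simp
  then have "real (\<Sum>j=1..i. length (round_queries f M Alg es j)) \<le> 2 * real (card Q)"
    by (metis of_nat_le_iff of_nat_mult of_nat_numeral)
  then show "amortized_queries f M Alg es i \<le> 2 * real (card Q) / real i"
    unfolding amortized_queries_def by (rule divide_right_mono) simp
qed

section \<open>The staged greedy algorithm\<close>

text \<open>\<open>y\<close> is meant to be the value of \<open>S\<close>, carried along so that it
  is not queried again. The target \<open>\<tau>\<close> is an absolute value of \<open>f\<close>,
  not a gain.\<close>

primrec scan :: "real \<Rightarrow> real \<Rightarrow> 'a list \<Rightarrow> 'a set \<Rightarrow> real \<Rightarrow> ('a, 'a set \<times> real) query_program" where
  "scan v \<tau> [] = (\<lambda>S y. Return (S, y))"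
| "scan v \<tau> (e # es) = (\<lambda>S y.
     if y \<ge> \<tau> then Return (S, y)
     else ask (insert e S) (\<lambda>b r. if b \<and> r - y \<ge> v then scan v \<tau> es (insert e S) r else scan v \<tau> es S y))"

text \<open>\<open>v\<close> is the threshold of the preceding stage, so the first scan already uses
  \<open>(1 - \<eta>) * v\<close>. The entries of the guess count units of \<open>\<delta>\<close>;
  an entry 0 closes its stage without a query.\<close>

primrec stages :: "real \<Rightarrow> real \<Rightarrow> 'a list \<Rightarrow> nat list \<Rightarrow> real \<Rightarrow> 'a set \<Rightarrow> real
    \<Rightarrow> ('a, 'a set \<times> real) query_program" where
  "stages \<eta> \<delta> xs [] = (\<lambda>v S y. Return (S, y))"
| "stages \<eta> \<delta> xs (g # gs) = (\<lambda>v S y. bind_program (scan ((1 - \<eta>) * v) (y + real g * \<delta>) xs S y)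
     (\<lambda>(S', y'). if y' \<ge> y + real g * \<delta> then stages \<eta> \<delta> xs gs ((1 - \<eta>) * v) S' y' else Return (S', y')))"

lemma scan_done: "y \<ge> \<tau> \<Longrightarrow> scan v \<tau> xs S y = Return (S, y)"
  by (cases xs) auto

text \<open>The rest of a scan depends on \<open>xs\<close> only through the state reached; if the
  target was met on \<open>xs\<close>, then \<open>scan_done\<close> makes the remainder do
  nothing.\<close>

lemma scan_append:
  "scan v \<tau> (xs @ ys) S y = bind_program (scan v \<tau> xs S y) (\<lambda>(S', y'). scan v \<tau> ys S' y')"
  by (induction xs arbitrary: S y) (auto simp: scan_done ask_def fun_eq_iff)

lemma length_queries_scan: "length (queries f M (scan v \<tau> xs S y)) \<le> 2 * length xs"
  by (induction xs arbitrary: S y) auto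

lemma stages_Cons:
  assumes "result f M (scan ((1 - \<eta>) * v) (y + real g * \<delta>) xs S y) = (S', y')"
  shows "result f M (stages \<eta> \<delta> xs (g # gs) v S y) =
      (if y' \<ge> y + real g * \<delta> then result f M (stages \<eta> \<delta> xs gs ((1 - \<eta>) * v) S' y') else (S', y'))"
    and "queries f M (stages \<eta> \<delta> xs (g # gs) v S y) =
      queries f M (scan ((1 - \<eta>) * v) (y + real g * \<delta>) xs S y) @
      (if y' \<ge> y + real g * \<delta> then queries f M (stages \<eta> \<delta> xs gs ((1 - \<eta>) * v) S' y') else [])"
  using assms by auto

lemma length_queries_stages:
  "length (queries f M (stages \<eta> \<delta> xs gs v S y)) \<le> 2 * length gs * length xs"
proof (induction gs arbitrary: v S y)
  case (Cons g gs)
  obtain S' y' where r: "result f M (scan ((1 - \<eta>) * v) (y + real g * \<delta>) xs S y) = (S', y')" by fastforce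
  show ?case
    using Cons[of "(1 - \<eta>) * v" S' y'] length_queries_scan[of f M "(1 - \<eta>) * v" "y + real g * \<delta>" xs S y]
    by (simp add: stages_Cons(2)[OF r] del: stages.simps(2))
qed auto

text \<open>A closed stage ignores later arrivals, and an open stage blocks the following ones.\<close>

lemma queries_stages_append:
  "set (queries f M (stages \<eta> \<delta> xs gs v S y)) \<subseteq> set (queries f M (stages \<eta> \<delta> (xs @ ys) gs v S y))"
proof (induction gs arbitrary: v S y)
  case (Cons g gs)
  obtain S' y' where r: "result f M (scan ((1 - \<eta>) * v) (y + real g * \<delta>) xs S y) = (S', y')" by fastforce
  show ?case
    using Cons[of "(1 - \<eta>) * v" S' y'] by (auto simp: r scan_append scan_done)
qed auto

lemma scan_state:
  assumes "result f M (scan v \<tau> xs S y) = (S', y')" "y = f S" "S \<in> M"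
  shows "S \<subseteq> S' \<and> S' \<subseteq> S \<union> set xs \<and> y' = f S' \<and> S' \<in> M \<and>
    \<Union> (set (queries f M (scan v \<tau> xs S y))) \<subseteq> S \<union> set xs"
  using assms
proof (induction xs arbitrary: S y)
  case (Cons e xs)
  show ?case
  proof (cases "y \<ge> \<tau>")
    case True
    then show ?thesis using Cons.prems by auto
  next
    case False
    show ?thesis
    proof (cases "insert e S \<in> M \<and> f (insert e S) - y \<ge> v")
      case True
      then have "result f M (scan v \<tau> xs (insert e S) (f (insert e S))) = (S', y')"
        using Cons.prems False by simp
      from Cons.IH[OF this refl] True False show ?thesis by auto
    next
      case no: False
      then have "result f M (scan v \<tau> xs S y) = (S', y')"
        using Cons.prems False by auto
      from Cons.IH[OF this Cons.prems(2,3)] no False show ?thesis by auto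
    qed
  qed
qed auto

lemma stages_state:
  assumes "result f M (stages \<eta> \<delta> xs gs v S y) = (S', y')" "y = f S" "S \<in> M"
  shows "S' \<subseteq> S \<union> set xs \<and> y' = f S' \<and> S' \<in> M \<and>
    \<Union> (set (queries f M (stages \<eta> \<delta> xs gs v S y))) \<subseteq> S \<union> set xs"
  using assms
proof (induction gs arbitrary: v S y)
  case (Cons g gs)
  obtain S1 y1 where r: "result f M (scan ((1 - \<eta>) * v) (y + real g * \<delta>) xs S y) = (S1, y1)" by fastforce
  note s = scan_state[OF r Cons.prems(2,3)]
  show ?case
  proof (cases "y1 \<ge> y + real g * \<delta>")
    case True
    then have r2: "result f M (stages \<eta> \<delta> xs gs ((1 - \<eta>) * v) S1 y1) = (S', y')"
      using Cons.prems(1) stages_Cons(1)[OF r] by (simp del: stages.simps(2))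
    have s2: "S' \<subseteq> S1 \<union> set xs \<and> y' = f S' \<and> S' \<in> M \<and>
      \<Union> (set (queries f M (stages \<eta> \<delta> xs gs ((1 - \<eta>) * v) S1 y1))) \<subseteq> S1 \<union> set xs"
      using Cons.IH[OF r2] s by blast
    have "queries f M (stages \<eta> \<delta> xs (g # gs) v S y) =
      queries f M (scan ((1 - \<eta>) * v) (y + real g * \<delta>) xs S y) @
      queries f M (stages \<eta> \<delta> xs gs ((1 - \<eta>) * v) S1 y1)"
      using True stages_Cons(2)[OF r] by (simp del: stages.simps(2))
    then show ?thesis using s s2 by (simp add: Un_subset_iff) blast
  next
    case False
    then have "queries f M (stages \<eta> \<delta> xs (g # gs) v S y) =
        queries f M (scan ((1 - \<eta>) * v) (y + real g * \<delta>) xs S y)" "S' = S1" "y' = y1"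
      using Cons.prems(1) stages_Cons[OF r] by (simp_all del: stages.simps(2))
    then show ?thesis using s by simp
  qed
qed auto

section \<open>Approximation guarantee for a suitable guess\<close>

locale matroid_submodular =
  fixes V :: "'a set" and M :: "'a set set" and f :: "'a set \<Rightarrow> real"
  assumes matroid: "matroid V M" and nms: "nonneg_monotone_submodular V f"
begin

lemma indep_subset: "S \<in> M \<Longrightarrow> S \<subseteq> V"
  using matroid by (auto simp: matroid_def)

lemma indep_down: "S \<in> M \<Longrightarrow> T \<subseteq> S \<Longrightarrow> T \<in> M"
  using matroid unfolding matroid_def by blast

lemma empty_indep: "{} \<in> M"
  using matroid by (auto simp: matroid_def)

lemma finite_subset_ground: "S \<subseteq> V \<Longrightarrow> finite S"
  using matroid finite_subset by (auto simp: matroid_def)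

lemma indep_finite: "S \<in> M \<Longrightarrow> finite S"
  by (simp add: indep_subset finite_subset_ground)

lemma augment: "S \<in> M \<Longrightarrow> T \<in> M \<Longrightarrow> card S < card T \<Longrightarrow> \<exists>x\<in>T - S. insert x S \<in> M"
  using matroid by (simp add: matroid_def)

lemma f_mono: "A \<subseteq> B \<Longrightarrow> B \<subseteq> V \<Longrightarrow> f A \<le> f B"
  using nms mono_onD[of "Pow V" f A B] by (simp add: nonneg_monotone_submodular_def)

lemma f_submod: "A \<subseteq> V \<Longrightarrow> B \<subseteq> V \<Longrightarrow> f (A \<union> B) + f (A \<inter> B) \<le> f A + f B"
  using nms by (auto simp: nonneg_monotone_submodular_def submodular_on_def)

lemma f_nonneg: "A \<subseteq> V \<Longrightarrow> 0 \<le> f A"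
  using nms by (auto simp: nonneg_monotone_submodular_def)

text \<open>For \<open>x\<close> outside \<open>B\<close> this is submodularity of the pair
  \<open>B\<close>, \<open>insert x A\<close>, whose intersection is \<open>A\<close>; for
  \<open>x\<close> in \<open>B\<close> the left side vanishes and monotonicity suffices.\<close>

lemma diminishing:
  assumes "A \<subseteq> B" "B \<subseteq> V" "x \<in> V"
  shows "f (insert x B) - f B \<le> f (insert x A) - f A"
proof (cases "x \<in> B")
  case True
  then have "insert x B = B" by auto
  then show ?thesis using f_mono[of A "insert x A"] assms by (auto simp: subset_insertI)
next
  case False
  then have "B \<union> insert x A = insert x B" "B \<inter> insert x A = A" using assms by auto
  moreover have "A \<subseteq> V" using assms by blast
  ultimately show ?thesis using f_submod[of B "insert x A"] assms by simp
qed

lemma sum_marginals: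
  assumes "S \<subseteq> V" "T \<subseteq> V"
  shows "f (S \<union> T) \<le> f S + (\<Sum>x\<in>T. f (insert x S) - f S)"
  using finite_subset_ground[OF assms(2)] assms(2)
proof (induction T)
  case (insert x T)
  have "f (insert x (S \<union> T)) - f (S \<union> T) \<le> f (insert x S) - f S"
    using insert assms(1) by (intro diminishing) auto
  then show ?case using insert by auto
qed simp

lemma extend_indep:
  assumes "S \<in> M" "T \<in> M"
  shows "\<exists>R. R \<subseteq> T \<and> S \<union> R \<in> M \<and> card T \<le> card (S \<union> R)"
  using assms
proof (induction "card T - card S" arbitrary: S)
  case 0
  then show ?case by (intro exI[of _ "{}"]) auto
next
  case (Suc n)
  then have "card S < card T" by simp
  then obtain x where x: "x \<in> T - S" "insert x S \<in> M" using augment Suc.prems by blast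
  have "finite S" using Suc.prems(1) by (rule indep_finite)
  then have "card (insert x S) = Suc (card S)" using x by simp
  then have "n = card T - card (insert x S)" using Suc.hyps(2) by simp
  from Suc.hyps(1)[OF this x(2) Suc.prems(2)] obtain R where
    "R \<subseteq> T" "insert x S \<union> R \<in> M" "card T \<le> card (insert x S \<union> R)" by blast
  then show ?case using x by (intro exI[of _ "insert x R"]) auto
qed

text \<open>Extend \<open>S \<union> Y\<close> by elements of \<open>S \<union> A\<close> until it
  is at least as large as \<open>S \<union> A\<close>. Only elements of \<open>Y\<close> can lie
  outside \<open>S \<union> A\<close>, so at most \<open>card Y\<close> elements of \<open>A\<close>
  are left out. This lets each element of \<open>Y\<close> pay for at most one lost element of
  \<open>A\<close>.\<close>

lemma exchange:
  assumes "S \<union> A \<in> M" "S \<union> Y \<in> M"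
  shows "\<exists>B\<subseteq>A. S \<union> Y \<union> B \<in> M \<and> card (A - B) \<le> card Y"
proof -
  obtain R where R: "R \<subseteq> S \<union> A" "(S \<union> Y) \<union> R \<in> M" "card (S \<union> A) \<le> card (S \<union> Y \<union> R)"
    using extend_indep[OF assms(2,1)] by blast
  define B where "B = A \<inter> (S \<union> Y \<union> R)"
  have "S \<union> Y \<union> B = S \<union> Y \<union> R" using R(1) by (auto simp: B_def)
  then have 1: "S \<union> Y \<union> B \<in> M" using R by simp
  have fin: "finite (S \<union> A)" "finite (S \<union> Y \<union> R)"
    using R(2) assms by (simp_all add: indep_finite del: finite_Un)
  have finY: "finite Y" using indep_finite[OF assms(2)] by simp
  define Z where "Z = S \<union> Y \<union> R"
  have "card (S \<union> A) = card ((S \<union> A) \<inter> Z) + card ((S \<union> A) - Z)"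
    using fin by (metis card_Int_Diff)
  moreover have "card Z = card ((S \<union> A) \<inter> Z) + card (Z - (S \<union> A))"
    using fin by (metis Z_def card_Int_Diff inf_commute)
  moreover have "card (Z - (S \<union> A)) \<le> card Y"
    using R(1) finY by (intro card_mono) (auto simp: Z_def)
  moreover have "A - B = (S \<union> A) - Z" by (auto simp: B_def Z_def)
  ultimately have "card (A - B) \<le> card Y" using R(3) by (simp add: Z_def)
  then show ?thesis using 1 by (auto simp: B_def)
qed

section \<open>Gains, capping and rejections in a single scan\<close>

lemma scan_step_cases:
  assumes "result f M (scan v \<tau> (e # xs) S (f S)) = (S', y')" "\<not> f S \<ge> \<tau>"
  obtains "insert e S \<in> M" "f (insert e S) - f S \<ge> v"
      "result f M (scan v \<tau> xs (insert e S) (f (insert e S))) = (S', y')"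
    | "\<not> (insert e S \<in> M \<and> f (insert e S) - f S \<ge> v)" "result f M (scan v \<tau> xs S (f S)) = (S', y')"
  using assms by (auto split: if_splits)

lemma card_Diff_insert_le:
  assumes "finite B"
  shows "card (B - S) \<le> card (B - insert e S) + 1"
proof -
  have "card (B - S) \<le> card (insert e (B - insert e S))"
    using assms by (intro card_mono) auto
  also have "\<dots> \<le> card (B - insert e S) + 1" by (simp add: card_insert_if assms)
  finally show ?thesis .
qed

lemma scan_gain:
  assumes "result f M (scan v \<tau> xs S (f S)) = (S', y')" "v \<ge> 0" "S \<in> M"
  shows "v * card (S' - S) \<le> f S' - f S"
  using assms
proof (induction xs arbitrary: S)
  case (Cons e xs)
  show ?case
  proof (cases "f S \<ge> \<tau>")
    case True
    then show ?thesis using Cons.prems by auto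
  next
    case False
    from Cons.prems(1) False show ?thesis
    proof (cases rule: scan_step_cases)
      case 1
      have "finite S'" using scan_state[OF 1(3) refl 1(1)] by (simp add: indep_finite)
      then have "card (S' - S) \<le> card (S' - insert e S) + 1" by (rule card_Diff_insert_le)
      then have "v * card (S' - S) \<le> v * (card (S' - insert e S) + 1)"
        using Cons.prems(2) by (intro mult_left_mono) auto
      then have "v * card (S' - S) \<le> v * card (S' - insert e S) + v"
        by (simp add: algebra_simps)
      then show ?thesis using Cons.IH[OF 1(3) Cons.prems(2) 1(1)] 1(2) by linarith
    next
      case 2
      show ?thesis by (rule Cons.IH[OF 2(2) Cons.prems(2,3)])
    qed
  qed
qed auto

text \<open>The two scans agree step by step until the smaller target is met; from then on only the
  second one moves, and \<open>scan_gain\<close> applies to what it adds. It serves to compare the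
  actual stage with an uncapped one.\<close>

lemma scan_capped:
  assumes "result f M (scan v \<tau> xs S (f S)) = (S1, y1)" "result f M (scan v \<tau>' xs S (f S)) = (S2, y2)"
    and "\<tau> \<le> \<tau>'" "v \<ge> 0" "S \<in> M"
  shows "S1 \<subseteq> S2 \<and> v * card (S2 - S1) \<le> f S2 - f S1 \<and> (f S1 \<ge> \<tau> \<or> S1 = S2)"
  using assms
proof (induction xs arbitrary: S)
  case (Cons e xs)
  show ?case
  proof (cases "f S \<ge> \<tau>")
    case True
    then have "S1 = S" using Cons.prems(1) by simp
    then show ?thesis
      using True scan_gain[OF Cons.prems(2,4,5)] scan_state[OF Cons.prems(2) refl Cons.prems(5)] by auto
  next
    case False
    then have F: "\<not> f S \<ge> \<tau>'" using Cons.prems(3) by linarith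
    from Cons.prems(1) False show ?thesis
    proof (cases rule: scan_step_cases)
      case 1
      then have "result f M (scan v \<tau>' xs (insert e S) (f (insert e S))) = (S2, y2)"
        using Cons.prems(2) F by simp
      from Cons.IH[OF 1(3) this Cons.prems(3,4) 1(1)] show ?thesis .
    next
      case 2
      then have "result f M (scan v \<tau>' xs S (f S)) = (S2, y2)"
        using Cons.prems(2) F by (auto split: if_splits)
      from Cons.IH[OF 2(2) this Cons.prems(3-5)] show ?thesis .
    qed
  qed
qed auto

text \<open>A scan that misses its target has examined every element. A rejected \<open>e\<close>
  with \<open>insert e S' \<in> M\<close> was not rejected for dependence, so its marginal was below
  \<open>v\<close> at that time and stays so by \<open>diminishing\<close>. An accepted
  \<open>e\<close> has marginal 0, whence \<open>v > 0\<close>.\<close>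

lemma scan_complete:
  assumes "result f M (scan v \<tau> xs S (f S)) = (S', y')" "S \<in> M" "f S' < \<tau>" "v > 0"
    and "e \<in> set xs" "insert e S' \<in> M"
  shows "f (insert e S') - f S' < v"
  using assms
proof (induction xs arbitrary: S)
  case (Cons a xs)
  have st: "S \<subseteq> S'" "S' \<in> M" using scan_state[OF Cons.prems(1) refl Cons.prems(2)] by auto
  then have "f S \<le> f S'" by (simp add: f_mono indep_subset)
  then have F: "\<not> f S \<ge> \<tau>" using Cons.prems(3) by linarith
  from Cons.prems(1) F show ?case
  proof (cases rule: scan_step_cases)
    case 1
    show ?thesis
    proof (cases "e \<in> set xs")
      case True
      show ?thesis by (rule Cons.IH[OF 1(3) 1(1) Cons.prems(3,4) True Cons.prems(6)])
    next
      case False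
      then have "e \<in> S'" using Cons.prems(5) scan_state[OF 1(3) refl 1(1)] by auto
      then show ?thesis using Cons.prems(4) by (simp add: insert_absorb)
    qed
  next
    case 2
    show ?thesis
    proof (cases "e \<in> set xs")
      case True
      show ?thesis by (rule Cons.IH[OF 2(2) Cons.prems(2,3,4) True Cons.prems(6)])
    next
      case False
      then have "e = a" using Cons.prems(5) by simp
      have "insert e S \<in> M" using indep_down[OF Cons.prems(6)] st(1) by blast
      then have "f (insert e S) - f S < v" using 2(1) \<open>e = a\<close> by auto
      moreover have "f (insert e S') - f S' \<le> f (insert e S) - f S"
        using diminishing[OF st(1)] indep_subset[OF Cons.prems(6)] by simp
      ultimately show ?thesis by linarith
    qed
  qed
qed simp

end

text \<open>Elements outside \<open>A\<close> are charged and count with their full marginal; the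
  uncharged ones count only by their excess over the threshold. Adding \<open>card A * v\<close>
  hence bounds the sum of all marginals of \<open>Opt\<close> over \<open>T\<close>.\<close>

definition potential :: "('a set \<Rightarrow> real) \<Rightarrow> 'a set \<Rightarrow> real \<Rightarrow> 'a set \<Rightarrow> 'a set \<Rightarrow> real" where
  "potential f Opt v T A = (\<Sum>x\<in>Opt - A. f (insert x T) - f T) + (\<Sum>x\<in>A. max 0 (f (insert x T) - f T - v))"

section \<open>The stage invariant and its preservation\<close>

context matroid_submodular
begin

text \<open>\<open>D\<close> collects the elements that uncapped stages would have added to \<open>S\<close>, and \<open>A\<close> is the part of
  \<open>Opt\<close> that has not yet been charged to an element of \<open>S\<close>.\<close>

definition stage_inv where
  "stage_inv Opt U \<eta> \<delta> i v S D A \<longleftrightarrow>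
     S \<in> M \<and> S \<subseteq> U \<and> D \<subseteq> U \<and> A \<subseteq> Opt \<and> S \<union> A \<in> M \<and>
     f (S \<union> D) \<le> f S + real i * \<delta> \<and>
     potential f Opt v (S \<union> D) A \<le> (f S - f {}) / (1 - \<eta>) + real i * \<delta> * \<eta> / (1 - \<eta>)"

text \<open>Compare the uncapped result \<open>S2\<close> of the stage with the result
  \<open>S1\<close> for the gain rounded down. Elements of \<open>A\<close> displaced by
  \<open>S1 - S\<close> become charged; those displaced only by the missed elements
  \<open>S2 - S1\<close> stay uncharged and cost the drop of the threshold; the surviving ones were
  rejected by the uncapped scan and cost nothing.\<close>

lemma stage_step:
  assumes inv: "stage_inv Opt (set xs) \<eta> \<delta> i v S D A"
    and xs: "set xs \<subseteq> V" and Opt: "Opt \<subseteq> set xs" and \<eta>: "0 < \<eta>" "\<eta> < 1" and pos: "v > 0" "\<delta> > 0"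
  shows "\<exists>g S' D' A'. result f M (scan ((1 - \<eta>) * v) (f S + real g * \<delta>) xs S (f S)) = (S', f S') \<and>
    f S' \<ge> f S + real g * \<delta> \<and> stage_inv Opt (set xs) \<eta> \<delta> (Suc i) ((1 - \<eta>) * v) S' D' A'"
proof -
  define w where "w = (1 - \<eta>) * v"
  have w: "w > 0" "w \<le> v" using \<eta> pos by (auto simp: w_def algebra_simps)
  have S: "S \<in> M" "S \<subseteq> set xs" "D \<subseteq> set xs" "A \<subseteq> Opt" "S \<union> A \<in> M"
    and fD: "f (S \<union> D) \<le> f S + real i * \<delta>"
    and pot: "potential f Opt v (S \<union> D) A \<le> (f S - f {}) / (1 - \<eta>) + real i * \<delta> * \<eta> / (1 - \<eta>)"
    using inv by (auto simp: stage_inv_def)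
  \<comment> \<open>The target \<open>f V + 1\<close> exceeds every value of \<open>f\<close> on
    \<open>V\<close> by monotonicity, so this scan is uncapped.\<close>
  obtain S2 y2 where r2: "result f M (scan w (f V + 1) xs S (f S)) = (S2, y2)" by fastforce
  have S2: "S \<subseteq> S2" "S2 \<subseteq> set xs" "S2 \<in> M"
    using scan_state[OF r2 refl S(1)] S(2) by auto
  \<comment> \<open>Rounding the uncapped gain down makes the target attainable and leaves less than
    one unit \<open>\<delta>\<close> uncollected.\<close>
  define g where "g = nat \<lfloor>(f S2 - f S) / \<delta>\<rfloor>"
  have ge: "f S \<le> f S2" using f_mono S2 indep_subset by simp
  have "(f S2 - f S) / \<delta> \<ge> 0" using ge pos by simp
  then have "real g \<le> (f S2 - f S) / \<delta>" "(f S2 - f S) / \<delta> < real g + 1"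
    unfolding g_def by linarith+
  then have g: "real g * \<delta> \<le> f S2 - f S" "f S2 - f S < real g * \<delta> + \<delta>"
    using pos by (simp_all add: field_simps)
  obtain S1 y1 where r1: "result f M (scan w (f S + real g * \<delta>) xs S (f S)) = (S1, y1)" by fastforce
  have S1: "S \<subseteq> S1" "S1 \<subseteq> set xs" "S1 \<in> M" "y1 = f S1"
    using scan_state[OF r1 refl S(1)] S(2) by auto
  have S2V: "f S2 \<le> f V" using f_mono indep_subset[OF S2(3)] by simp
  have "f S + real g * \<delta> \<le> f V + 1" using g(1) S2V by linarith
  from scan_capped[OF r1 r2 this _ S(1)] w
  have c: "S1 \<subseteq> S2" "w * card (S2 - S1) \<le> f S2 - f S1" "f S1 \<ge> f S + real g * \<delta> \<or> S1 = S2" by auto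
  have reach: "f S1 \<ge> f S + real g * \<delta>" using c(3) g(1) by auto
  have loss: "f S2 - f S1 \<le> \<delta>" using reach g(2) by linarith
  define X where "X = S2 - S1"
  have S2X: "S2 = S1 \<union> X" using c(1) by (auto simp: X_def)
  \<comment> \<open>What the cap made the stage miss goes into \<open>D'\<close>, so that marginals
    are always measured over a set containing the uncapped result.\<close>
  define D' where "D' = D \<union> X"
  define T where "T = S \<union> D"
  define T' where "T' = S1 \<union> D'"
  have TT: "T \<subseteq> T'" "T' \<subseteq> V" "T \<subseteq> V" "S1 \<union> X \<subseteq> T'"
    using S S1 S2 xs c by (auto simp: T_def T'_def D'_def X_def)
  obtain A1 where A1: "A1 \<subseteq> A" "S1 \<union> A1 \<in> M" "card (A - A1) \<le> card (S1 - S)"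
  proof -
    have "S \<union> (S1 - S) \<in> M" using S1 by (simp add: Un_absorb1)
    from exchange[OF S(5) this] show ?thesis using that S1(1) by (auto simp: Un_absorb1)
  qed
  obtain B where B: "B \<subseteq> A1" "S2 \<union> B \<in> M" "card (A1 - B) \<le> card X"
  proof -
    have "S1 \<union> X \<in> M" using S2(3) S2X by simp
    from exchange[OF A1(2) this] show ?thesis using that S2X by auto
  qed
  define \<phi> where "\<phi> x = f (insert x T) - f T" for x
  define \<phi>' where "\<phi>' x = f (insert x T') - f T'" for x
  have OptV: "Opt \<subseteq> V" using Opt xs by simp
  have dec: "\<phi>' x \<le> \<phi> x" if "x \<in> Opt" for x
    unfolding \<phi>_def \<phi>'_def using diminishing[OF TT(1,2)] that OptV by auto
  have fin: "finite Opt" "finite A" "finite A1" "finite B"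
    using Opt S(4) A1(1) B(1) by (meson finite_set finite_subset)+
  \<comment> \<open>Elements surviving both exchanges can be added to \<open>S2\<close>, so the
    completed uncapped scan found them below the threshold \<open>w\<close>.\<close>
  have low: "\<phi>' x < w" if "x \<in> B" for x
  proof -
    have x: "x \<in> set xs" using that B(1) A1(1) S(4) Opt by blast
    have "insert x S2 \<in> M" using indep_down[OF B(2)] that by auto
    then have "f (insert x S2) - f S2 < w"
      using scan_complete[OF r2 S(1) _ w(1) x] S2V by simp
    moreover have "\<phi>' x \<le> f (insert x S2) - f S2"
      unfolding \<phi>'_def using diminishing[of S2 T' x] TT S2X x xs by auto
    ultimately show ?thesis by linarith
  qed
  have "potential f Opt w T' A1 = (\<Sum>x\<in>Opt - A1. \<phi>' x) + (\<Sum>x\<in>A1. max 0 (\<phi>' x - w))"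
    by (simp add: potential_def \<phi>'_def)
  also have "(\<Sum>x\<in>Opt - A1. \<phi>' x) = (\<Sum>x\<in>Opt - A. \<phi>' x) + (\<Sum>x\<in>A - A1. \<phi>' x)"
  proof -
    have "Opt - A1 = (Opt - A) \<union> (A - A1)" using S(4) A1(1) by auto
    then show ?thesis using fin by (simp add: sum.union_disjoint Diff_disjoint inf.commute disjoint_iff)
  qed
  also have "(\<Sum>x\<in>Opt - A. \<phi>' x) \<le> (\<Sum>x\<in>Opt - A. \<phi> x)" by (intro sum_mono dec) auto
  \<comment> \<open>A newly charged element was counted by its excess over \<open>v\<close> so far
    and now counts in full, which costs at most \<open>v\<close>.\<close>
  also have "(\<Sum>x\<in>A - A1. \<phi>' x) \<le> (\<Sum>x\<in>A - A1. max 0 (\<phi> x - v) + v)"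
    using dec S(4) by (intro sum_mono) (smt (verit) Diff_iff subsetD)
  also have "(\<Sum>x\<in>A1. max 0 (\<phi>' x - w)) = (\<Sum>x\<in>A1 - B. max 0 (\<phi>' x - w))"
    using fin B(1) by (intro sum.mono_neutral_right) (auto dest: low)
  also have "\<dots> \<le> (\<Sum>x\<in>A1 - B. max 0 (\<phi> x - v) + (v - w))"
    using dec S(4) A1(1) w by (intro sum_mono) (smt (verit) Diff_iff subsetD)
  finally have "potential f Opt w T' A1 \<le> (\<Sum>x\<in>Opt - A. \<phi> x) +
      ((\<Sum>x\<in>A - A1. max 0 (\<phi> x - v)) + (\<Sum>x\<in>A1 - B. max 0 (\<phi> x - v))) +
      card (A - A1) * v + card (A1 - B) * (v - w)"
    by (simp add: sum.distrib)
  also have "(\<Sum>x\<in>A - A1. max 0 (\<phi> x - v)) + (\<Sum>x\<in>A1 - B. max 0 (\<phi> x - v)) \<le> (\<Sum>x\<in>A. max 0 (\<phi> x - v))"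
  proof -
    have "(\<Sum>x\<in>A - A1. max 0 (\<phi> x - v)) + (\<Sum>x\<in>A1 - B. max 0 (\<phi> x - v))
        = (\<Sum>x\<in>(A - A1) \<union> (A1 - B). max 0 (\<phi> x - v))"
      using fin by (subst sum.union_disjoint) auto
    also have "\<dots> \<le> (\<Sum>x\<in>A. max 0 (\<phi> x - v))"
      using fin A1(1) by (intro sum_mono2) auto
    finally show ?thesis .
  qed
  finally have p: "potential f Opt w T' A1 \<le> potential f Opt v T A +
      card (A - A1) * v + card (A1 - B) * (v - w)"
    by (simp add: potential_def \<phi>_def)
  \<comment> \<open>There are at most \<open>card (S1 - S)\<close> newly charged elements, and each
    element of \<open>S1 - S\<close> gained at least \<open>w\<close>, that is
    \<open>(1 - \<eta>) * v\<close>. Here the factor \<open>1 / (1 - \<eta>)\<close> arises.\<close>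
  have "card (A - A1) * v \<le> (f S1 - f S) / (1 - \<eta>)"
  proof -
    have "card (A - A1) * w \<le> card (S1 - S) * w" using A1(3) w by simp
    also have "\<dots> \<le> f S1 - f S" using scan_gain[OF r1 _ S(1)] w by (simp add: mult.commute)
    finally show ?thesis using \<eta> by (simp add: w_def field_simps)
  qed
  \<comment> \<open>The missed elements would have gained at least \<open>w\<close> each but at most
    \<open>\<delta>\<close> together; their price \<open>v - w\<close> equals
    \<open>w * \<eta> / (1 - \<eta>)\<close>.\<close>
  moreover have "card (A1 - B) * (v - w) \<le> \<delta> * \<eta> / (1 - \<eta>)"
  proof -
    have "card (A1 - B) * w \<le> card X * w" using B(3) w by simp
    also have "\<dots> \<le> \<delta>" using c(2) loss by (simp add: X_def mult.commute)
    finally have "card (A1 - B) * w * \<eta> \<le> \<delta> * \<eta>" using \<eta> by simp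
    then have "card (A1 - B) * w * \<eta> / (1 - \<eta>) \<le> \<delta> * \<eta> / (1 - \<eta>)"
      using \<eta> by (simp add: divide_right_mono)
    moreover have "w * \<eta> / (1 - \<eta>) = v - w" using \<eta> by (simp add: w_def field_simps)
    ultimately show ?thesis by (metis mult.assoc times_divide_eq_right)
  qed
  ultimately have "potential f Opt w T' A1 \<le> (f S - f {}) / (1 - \<eta>) + real i * \<delta> * \<eta> / (1 - \<eta>) +
      (f S1 - f S) / (1 - \<eta>) + \<delta> * \<eta> / (1 - \<eta>)"
    using p pot by (simp add: T_def)
  also have "\<dots> = (f S1 - f {}) / (1 - \<eta>) + real (Suc i) * \<delta> * \<eta> / (1 - \<eta>)"
    by (simp add: diff_divide_distrib add_divide_distrib distrib_left distrib_right)
  finally have pot': "potential f Opt w (S1 \<union> D') A1 \<le>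
      (f S1 - f {}) / (1 - \<eta>) + real (Suc i) * \<delta> * \<eta> / (1 - \<eta>)" by (simp add: T'_def)
  have "f (S1 \<union> D') \<le> f S1 + real (Suc i) * \<delta>"
  proof -
    \<comment> \<open>Submodularity of \<open>S2\<close> and \<open>T\<close>, which both contain
      \<open>S\<close>, makes the loss of this stage simply add to the earlier ones.\<close>
    have "T' = S2 \<union> T" using S1(1) S2X by (auto simp: T'_def T_def D'_def)
    moreover have "f S \<le> f (S2 \<inter> T)"
      using S2(1) TT by (intro f_mono) (auto simp: T_def)
    moreover have "f (S2 \<union> T) + f (S2 \<inter> T) \<le> f S2 + f T"
      using TT indep_subset[OF S2(3)] by (intro f_submod)
    ultimately show ?thesis using fD loss by (simp add: T'_def T_def algebra_simps)
  qed
  moreover have "D' \<subseteq> set xs" using S(3) S2(2) by (auto simp: D'_def X_def)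
  ultimately have "stage_inv Opt (set xs) \<eta> \<delta> (Suc i) w S1 D' A1"
    using S1 A1 S(4) pot' by (auto simp: stage_inv_def)
  then show ?thesis using r1 S1(4) reach unfolding w_def by blast
qed

text \<open>Iteration of \<open>stage_step\<close>. Since every target is reached, the guessed gains
  add up to at most the real one, which later bounds the guesses to be enumerated.\<close>

lemma stages_exist:
  assumes "stage_inv Opt (set xs) \<eta> \<delta> i v S D A"
    and "set xs \<subseteq> V" "Opt \<subseteq> set xs" "0 < \<eta>" "\<eta> < 1" "v > 0" "\<delta> > 0"
  shows "\<exists>gs S' D' A'. length gs = m \<and> result f M (stages \<eta> \<delta> xs gs v S (f S)) = (S', f S') \<and>
    real (sum_list gs) * \<delta> \<le> f S' - f S \<and> stage_inv Opt (set xs) \<eta> \<delta> (i + m) ((1 - \<eta>) ^ m * v) S' D' A'"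
  using assms
proof (induction m arbitrary: i v S D A)
  case 0
  then show ?case by (intro exI[of _ "[]"]) auto
next
  case (Suc m)
  from stage_step[OF Suc.prems] obtain g S1 D1 A1 where
    1: "result f M (scan ((1 - \<eta>) * v) (f S + real g * \<delta>) xs S (f S)) = (S1, f S1)"
      "f S1 \<ge> f S + real g * \<delta>" "stage_inv Opt (set xs) \<eta> \<delta> (Suc i) ((1 - \<eta>) * v) S1 D1 A1"
    by blast
  have "(1 - \<eta>) * v > 0" using Suc.prems by simp
  from Suc.IH[OF 1(3) Suc.prems(2-5) this Suc.prems(7)] obtain gs S' D' A' where
    2: "length gs = m" "result f M (stages \<eta> \<delta> xs gs ((1 - \<eta>) * v) S1 (f S1)) = (S', f S')"
      "real (sum_list gs) * \<delta> \<le> f S' - f S1"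
      "stage_inv Opt (set xs) \<eta> \<delta> (Suc i + m) ((1 - \<eta>) ^ m * ((1 - \<eta>) * v)) S' D' A'"
    by blast
  have "result f M (stages \<eta> \<delta> xs (g # gs) v S (f S)) = (S', f S')"
    using stages_Cons(1)[OF 1(1)] 1(2) 2(2) by (simp del: stages.simps)
  moreover have "real (sum_list (g # gs)) * \<delta> \<le> f S' - f S"
    using 1(2) 2(3) by (simp add: distrib_right)
  moreover have "stage_inv Opt (set xs) \<eta> \<delta> (i + Suc m) ((1 - \<eta>) ^ Suc m * v) S' D' A'"
    using 2(4) by (simp add: mult_ac)
  ultimately show ?case using 2(1) by (intro exI[of _ "g # gs"]) auto
qed

text \<open>Initially all of \<open>Opt\<close> is uncharged, and \<open>W\<close> bounds all its
  marginals, so the potential is 0. The final error consists of three terms of at most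
  \<open>\<eta> * W\<close>: the value missed by the caps (\<open>L\<close> times
  \<open>\<delta>\<close>), the rounding term of the potential, and at most \<open>k\<close>
  uncharged elements below the last threshold.\<close>

lemma guess_exists:
  assumes xs: "set xs \<subseteq> V" and Opt: "Opt \<subseteq> set xs" "Opt \<in> M" "card Opt \<le> k"
    and \<eta>: "0 < \<eta>" "\<eta> \<le> 1 / 2" and W: "W > 0" "\<And>x. x \<in> Opt \<Longrightarrow> f {x} - f {} \<le> W"
    and L: "L > 0" "real k * (1 - \<eta>) ^ L \<le> \<eta>"
  defines "\<delta> \<equiv> \<eta> * W / real L"
  shows "\<exists>gs S. length gs = L \<and> result f M (stages \<eta> \<delta> xs gs W {} (f {})) = (S, f S) \<and> S \<in> M \<and> S \<subseteq> set xs \<and>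
    real (sum_list gs) * \<delta> \<le> f S - f {} \<and>
    f Opt - f {} \<le> (f S - f {}) * (1 + 1 / (1 - \<eta>)) + 3 * \<eta> * W"
proof -
  have \<delta>: "\<delta> > 0" using \<eta> W L by (simp add: \<delta>_def)
  have "potential f Opt W {} Opt = 0"
    using W(2) by (auto simp: potential_def intro!: sum.neutral)
  then have "stage_inv Opt (set xs) \<eta> \<delta> 0 W {} {} Opt"
    using Opt empty_indep by (simp add: stage_inv_def)
  from stages_exist[OF this xs Opt(1) \<eta>(1) _ W(1) \<delta>, of L] \<eta> obtain gs S D A where
    gs: "length gs = L" "result f M (stages \<eta> \<delta> xs gs W {} (f {})) = (S, f S)"
    "real (sum_list gs) * \<delta> \<le> f S - f {}" and inv: "stage_inv Opt (set xs) \<eta> \<delta> L ((1 - \<eta>) ^ L * W) S D A"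
    by auto
  define v where "v = (1 - \<eta>) ^ L * W"
  define T where "T = S \<union> D"
  define \<phi> where "\<phi> x = f (insert x T) - f T" for x
  have S: "S \<in> M" "S \<subseteq> set xs" "D \<subseteq> set xs" "A \<subseteq> Opt"
    and fD: "f T \<le> f S + real L * \<delta>"
    and pot: "potential f Opt v T A \<le> (f S - f {}) / (1 - \<eta>) + real L * \<delta> * \<eta> / (1 - \<eta>)"
    using inv by (auto simp: stage_inv_def v_def T_def)
  have finO: "finite Opt" using Opt(2) by (rule indep_finite)
  have v: "v \<ge> 0" using \<eta> W by (simp add: v_def)
  have L\<delta>: "real L * \<delta> = \<eta> * W" using L by (simp add: \<delta>_def)
  have T: "T \<subseteq> V" using S xs by (auto simp: T_def)
  have "f Opt \<le> f (T \<union> Opt)" using T Opt xs by (intro f_mono) auto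
  also have "\<dots> \<le> f T + (\<Sum>x\<in>Opt. \<phi> x)"
    unfolding \<phi>_def using T Opt xs by (intro sum_marginals) auto
  also have "(\<Sum>x\<in>Opt. \<phi> x) = (\<Sum>x\<in>Opt - A. \<phi> x) + (\<Sum>x\<in>A. \<phi> x)"
    using finO S(4) by (rule sum.subset_diff[rotated])
  also have "(\<Sum>x\<in>A. \<phi> x) \<le> (\<Sum>x\<in>A. max 0 (\<phi> x - v) + v)" by (intro sum_mono) auto
  also have "\<dots> = (\<Sum>x\<in>A. max 0 (\<phi> x - v)) + card A * v" by (simp add: sum.distrib)
  also have "card A * v \<le> \<eta> * W"
  proof -
    have "card A \<le> k" using card_mono[OF finO S(4)] Opt(3) by simp
    then have "card A * v \<le> k * v" using v by (intro mult_right_mono) auto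
    also have "\<dots> = (k * (1 - \<eta>) ^ L) * W" by (simp add: v_def)
    also have "\<dots> \<le> \<eta> * W" using L(2) W by (intro mult_right_mono) auto
    finally show ?thesis .
  qed
  finally have "f Opt \<le> f T + potential f Opt v T A + \<eta> * W"
    by (simp add: potential_def \<phi>_def)
  also have "potential f Opt v T A \<le> (f S - f {}) / (1 - \<eta>) + \<eta> * W"
  proof -
    have "\<eta> / (1 - \<eta>) \<le> 1" using \<eta> by simp
    then have "\<eta> * W * (\<eta> / (1 - \<eta>)) \<le> \<eta> * W * 1" using \<eta> W by (intro mult_left_mono) auto
    then show ?thesis using pot L\<delta> by simp
  qed
  also have "f T \<le> f S + \<eta> * W" using fD L\<delta> by simp
  finally have "f Opt - f {} \<le> (f S - f {}) * (1 + 1 / (1 - \<eta>)) + 3 * \<eta> * W"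
    by (simp add: distrib_left mult_ac)
  then show ?thesis using gs S by blast
qed

end

section \<open>Enumerating the guesses\<close>

text \<open>The lists of length \<open>L\<close> with sum at most \<open>N\<close>; there are as
  many as the binomial coefficient \<open>N + L\<close> over \<open>L\<close>.\<close>

primrec guesses :: "nat \<Rightarrow> nat \<Rightarrow> nat list list" where
  "guesses 0 = (\<lambda>N. [[]])"
| "guesses (Suc L) = (\<lambda>N. concat (map (\<lambda>n. map ((#) n) (guesses L (N - n))) [0..<Suc N]))"

lemma in_guesses: "length gs = L \<Longrightarrow> sum_list gs \<le> N \<Longrightarrow> gs \<in> set (guesses L N)"
proof (induction L arbitrary: gs N)
  case (Suc L)
  obtain g hs where gs: "gs = g # hs" using Suc.prems(1) by (cases gs) auto
  have "hs \<in> set (guesses L (N - g))" using Suc gs by auto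
  then show ?case using Suc.prems gs by (auto simp del: upt_Suc intro!: bexI[of _ g])
qed simp

lemma length_in_guesses: "gs \<in> set (guesses L N) \<Longrightarrow> length gs = L"
  by (induction L arbitrary: gs N) auto

text \<open>For \<open>N \<le> L x\<close> the second factor is at most \<open>e\<^sup>L\<close>.\<close>

lemma length_guesses:
  fixes x :: real
  assumes "x > 0"
  shows "real (length (guesses L N)) \<le> (1 + x) ^ L * (1 + 1 / x) ^ N"
proof (induction L arbitrary: N)
  case 0
  then show ?case using assms by (simp add: one_le_power)
next
  case (Suc L)
  \<comment> \<open>With this \<open>q\<close> one has \<open>q / (q - 1) = 1 + x\<close>, so
    summing over the first entry costs exactly one factor \<open>1 + x\<close>.\<close>
  define q where "q = 1 + 1 / x"
  have q: "q > 1" using assms by (simp add: q_def)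
  have "length (guesses (Suc L) N) = sum_list (map (\<lambda>n. length (guesses L (N - n))) [0..<Suc N])"
    by (simp add: length_concat comp_def del: upt_Suc)
  also have "\<dots> = (\<Sum>n\<in>set [0..<Suc N]. length (guesses L (N - n)))"
    by (rule interv_sum_list_conv_sum_set_nat)
  also have "set [0..<Suc N] = {..N}" by auto
  finally have "real (length (guesses (Suc L) N)) = (\<Sum>n\<le>N. real (length (guesses L (N - n))))" by simp
  also have "\<dots> \<le> (\<Sum>n\<le>N. (1 + x) ^ L * q ^ (N - n))"
    unfolding q_def by (intro sum_mono Suc.IH)
  also have "\<dots> = (1 + x) ^ L * (\<Sum>n\<le>N. q ^ n)"
    unfolding sum_distrib_left by (rule sum.reindex_bij_witness[of _ "\<lambda>n. N - n" "\<lambda>n. N - n"]) auto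
  also have "(\<Sum>n\<le>N. q ^ n) \<le> (1 + x) * q ^ N"
  proof -
    have "(\<Sum>n\<le>N. q ^ n) = (q ^ Suc N - 1) / (q - 1)"
      using q geometric_sum[of q "Suc N"] by (simp only: lessThan_Suc_atMost)
    also have "\<dots> \<le> q ^ Suc N / (q - 1)" using q by (intro divide_right_mono) auto
    also have "\<dots> = (1 + x) * q ^ N" using assms by (simp add: q_def field_simps)
    finally show ?thesis .
  qed
  finally show ?case using assms by (simp add: q_def mult_ac)
qed

definition relevant :: "real \<Rightarrow> nat \<Rightarrow> int \<Rightarrow> real \<Rightarrow> bool" where
  "relevant \<eta> k s x \<longleftrightarrow> \<eta> * 2 powr s \<le> real k * x \<and> x \<le> 2 powr s"

definition scales :: "real \<Rightarrow> nat \<Rightarrow> real \<Rightarrow> int list" where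
  "scales \<eta> k x = (if x > 0 then [\<lceil>log 2 x\<rceil>..\<lfloor>log 2 (real k * x / \<eta>)\<rfloor>] else [])"

lemma set_scales:
  assumes "\<eta> > 0" "k > 0"
  shows "s \<in> set (scales \<eta> k x) \<longleftrightarrow> relevant \<eta> k s x"
proof (cases "x > 0")
  case True
  then have "s \<in> set (scales \<eta> k x) \<longleftrightarrow> log 2 x \<le> s \<and> s \<le> log 2 (real k * x / \<eta>)"
    by (simp add: scales_def ceiling_le_iff le_floor_iff)
  also have "\<dots> \<longleftrightarrow> x \<le> 2 powr s \<and> 2 powr s \<le> real k * x / \<eta>"
    using True assms by (subst log_le_iff, simp, simp, subst le_log_iff) auto
  finally show ?thesis using assms by (auto simp: relevant_def field_simps)
next
  case False
  moreover have "\<not> relevant \<eta> k s x"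
  proof
    assume "relevant \<eta> k s x"
    then have "\<eta> * 2 powr s \<le> real k * x" by (simp add: relevant_def)
    moreover have "\<eta> * 2 powr s > 0" using assms by simp
    moreover have "real k * x \<le> 0" using False by (simp add: mult_nonneg_nonpos)
    ultimately show False by linarith
  qed
  ultimately show ?thesis by (simp add: scales_def)
qed

text \<open>The two ends of the interval differ by \<open>log 2 (real k / \<eta>)\<close> whatever
  \<open>x\<close> is. This makes the cost of an element independent of the rest of the
  stream.\<close>

lemma length_scales:
  assumes "\<eta> > 0" "real k \<ge> \<eta>"
  shows "real (length (scales \<eta> k x)) \<le> log 2 (real k / \<eta>) + 1"
proof (cases "x > 0")
  case True
  have k: "real k > 0" using assms by linarith
  have "log 2 (real k * x / \<eta>) = log 2 (real k / \<eta> * x)" by simp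
  also have "\<dots> = log 2 (real k / \<eta>) + log 2 x"
    using True assms k by (intro log_mult_pos) auto
  finally have l: "log 2 (real k * x / \<eta>) = log 2 (real k / \<eta>) + log 2 x" .
  have "log 2 (real k / \<eta>) \<ge> 0" using assms k by simp
  then show ?thesis using True unfolding scales_def by (simp add: l) linarith
next
  case False
  then show ?thesis using assms by (simp add: scales_def)
qed

section \<open>The offline program\<close>

definition survey :: "'a list \<Rightarrow> ('a, ('a \<times> bool \<times> real) list) query_program" where
  "survey xs = map_program (\<lambda>e. ask {e} (\<lambda>b y. Return (e, b, y))) xs"

definition select :: "real \<Rightarrow> nat \<Rightarrow> real \<Rightarrow> ('a \<times> bool \<times> real) list \<Rightarrow> int \<Rightarrow> 'a list" where
  "select \<eta> k y0 zs s = map fst (filter (\<lambda>(e, b, y). b \<and> relevant \<eta> k s (y - y0)) zs)"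

definition best :: "('a set \<times> real) list \<Rightarrow> 'a set" where
  "best rs = fst (arg_max_on snd (set rs))"

text \<open>Only scales relevant to some element are tried, which keeps the search finite without a
  bound on \<open>f\<close>. The empty set guarantees the value \<open>f {}\<close>, and the
  feasible singletons settle rank one.\<close>

definition offline :: "real \<Rightarrow> nat \<Rightarrow> nat \<Rightarrow> nat list list \<Rightarrow> 'a list \<Rightarrow> ('a, 'a set) query_program" where
  "offline \<eta> k L G xs = ask {} (\<lambda>_ y0. bind_program (survey xs) (\<lambda>zs. bind_program
     (map_program (\<lambda>(s, gs). stages \<eta> (\<eta> * 2 powr s / real L) (select \<eta> k y0 zs s) gs (2 powr s) {} y0)
       (List.product (concat (map (\<lambda>(e, b, y). scales \<eta> k (y - y0)) zs)) G))
     (\<lambda>rs. Return (best (({}, y0) # map (\<lambda>(e, b, y). ({e}, y)) (filter (\<lambda>(e, b, y). b) zs) @ rs)))))"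

lemma best_correct:
  assumes "r \<in> set rs" "\<And>S y. (S, y) \<in> set rs \<Longrightarrow> y = f S"
  shows "\<exists>y. (best rs, y) \<in> set rs" and "f (fst r) \<le> f (best rs)"
proof -
  have ne: "finite (set rs)" "set rs \<noteq> {}" using assms(1) by auto
  define m where "m = arg_max_on snd (set rs)"
  have "is_arg_max snd (\<lambda>r. r \<in> set rs) m"
  proof -
    have "Max (snd ` set rs) \<in> snd ` set rs" using ne by (intro Max_in) auto
    then obtain q where q: "q \<in> set rs" "snd q = Max (snd ` set rs)" by auto
    then have "\<forall>p\<in>set rs. snd p \<le> snd q" using ne by auto
    with q(1) have "is_arg_max snd (\<lambda>r. r \<in> set rs) q" by (auto simp: is_arg_max_linorder)
    then show ?thesis unfolding m_def arg_max_on_def arg_max_def by (rule someI)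
  qed
  then have m: "m \<in> set rs" "\<And>p. p \<in> set rs \<Longrightarrow> snd p \<le> snd m"
    by (auto simp: is_arg_max_linorder)
  have b: "best rs = fst m" by (simp add: best_def m_def)
  have v: "snd p = f (fst p)" if "p \<in> set rs" for p using that assms(2)[of "fst p" "snd p"] by simp
  show "\<exists>y. (best rs, y) \<in> set rs" using m(1) by (intro exI[of _ "snd m"]) (simp add: b)
  show "f (fst r) \<le> f (best rs)" using m(2)[OF assms(1)] v[OF m(1)] v[OF assms(1)] by (simp add: b)
qed

text \<open>This and the next three definitions describe, directly in terms of \<open>f\<close> and
  \<open>M\<close>, what \<open>offline\<close> computes once the survey has been answered.\<close>

definition candidates where
  "candidates f M \<eta> k xs s = filter (\<lambda>e. {e} \<in> M \<and> relevant \<eta> k s (f {e} - f {})) xs"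

definition relevant_scales where
  "relevant_scales f \<eta> k xs = concat (map (\<lambda>e. scales \<eta> k (f {e} - f {})) xs)"

definition staged where
  "staged f M \<eta> k L xs s gs =
     stages \<eta> (\<eta> * 2 powr s / real L) (candidates f M \<eta> k xs s) gs (2 powr (real_of_int s)) {} (f {})"

definition outcomes where
  "outcomes f M \<eta> k L G xs = ({}, f {}) # map (\<lambda>e. ({e}, f {e})) (filter (\<lambda>e. {e} \<in> M) xs) @
     map (\<lambda>(s, gs). result f M (staged f M \<eta> k L xs s gs)) (List.product (relevant_scales f \<eta> k xs) G)"

lemma result_survey: "result f M (survey xs) = map (\<lambda>e. (e, {e} \<in> M, f {e})) xs"
  by (simp add: survey_def)

lemma select_survey: "select \<eta> k (f {}) (map (\<lambda>e. (e, {e} \<in> M, f {e})) xs) s = candidates f M \<eta> k xs s"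
  by (simp add: select_def candidates_def filter_map comp_def)

lemma result_offline: "result f M (offline \<eta> k L G xs) = best (outcomes f M \<eta> k L G xs)"
  unfolding offline_def outcomes_def staged_def
  by (simp add: result_survey select_survey relevant_scales_def
      filter_map comp_def case_prod_unfold)

lemma queries_offline:
  "set (queries f M (offline \<eta> k L G xs)) = insert {} ((\<lambda>e. {e}) ` set xs) \<union>
     (\<Union>s\<in>set (relevant_scales f \<eta> k xs). \<Union>gs\<in>set G. set (queries f M (staged f M \<eta> k L xs s gs)))"
  unfolding offline_def staged_def
  by (auto simp add: result_survey select_survey relevant_scales_def
      comp_def case_prod_unfold survey_def)

text \<open>Appending to the stream appends to each list of candidates and only adds scales, so
  \<open>queries_stages_append\<close> applies for every scale and guess. Hence counting the
  distinct queries of the last prefix covers all earlier rounds.\<close>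

lemma queries_offline_append:
  "set (queries f M (offline \<eta> k L G xs)) \<subseteq> set (queries f M (offline \<eta> k L G (xs @ ys)))"
proof -
  have "set (queries f M (staged f M \<eta> k L xs s gs)) \<subseteq> set (queries f M (staged f M \<eta> k L (xs @ ys) s gs))" for s gs
    unfolding staged_def candidates_def filter_append by (rule queries_stages_append)
  moreover have "set (relevant_scales f \<eta> k xs) \<subseteq> set (relevant_scales f \<eta> k (xs @ ys))"
    by (auto simp: relevant_scales_def)
  ultimately show ?thesis unfolding queries_offline by (intro Un_mono UN_mono insert_mono image_mono) auto
qed

text \<open>Double counting: instead of the candidates of each scale, count for each element the
  scales to which it is relevant.\<close>

lemma sum_length_candidates:
  assumes "\<eta> > 0" "real k \<ge> \<eta>" "finite R"
  shows "real (\<Sum>s\<in>R. length (candidates f M \<eta> k xs s)) \<le> real (length xs) * (log 2 (real k / \<eta>) + 1)"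
proof (induction xs)
  case (Cons e xs)
  define c where "c s = (if {e} \<in> M \<and> relevant \<eta> k s (f {e} - f {}) then 1 else 0 :: nat)" for s
  have "k > 0" using assms by (cases k) auto
  have "(\<Sum>s\<in>R. c s) = card {s \<in> R. {e} \<in> M \<and> relevant \<eta> k s (f {e} - f {})}"
    unfolding c_def using assms(3) by (simp add: sum.If_cases Int_def)
  also have "\<dots> \<le> card (set (scales \<eta> k (f {e} - f {})))"
    using set_scales[OF assms(1) \<open>k > 0\<close>] by (intro card_mono) auto
  also have "\<dots> \<le> length (scales \<eta> k (f {e} - f {}))" by (rule card_length)
  finally have "real (\<Sum>s\<in>R. c s) \<le> real (length (scales \<eta> k (f {e} - f {})))"
    by (simp only: of_nat_le_iff)
  also have "\<dots> \<le> log 2 (real k / \<eta>) + 1" by (rule length_scales[OF assms(1,2)])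
  finally have c: "real (\<Sum>s\<in>R. c s) \<le> log 2 (real k / \<eta>) + 1" .
  have "(\<Sum>s\<in>R. length (candidates f M \<eta> k (e # xs) s)) =
      (\<Sum>s\<in>R. c s) + (\<Sum>s\<in>R. length (candidates f M \<eta> k xs s))"
    unfolding sum.distrib[symmetric] by (intro sum.cong) (auto simp: candidates_def c_def)
  then show ?case using c Cons.IH by (simp add: algebra_simps)
qed (simp add: candidates_def)

lemma card_queries_offline:
  assumes "\<eta> > 0" "real k \<ge> \<eta>" and G: "\<And>gs. gs \<in> set G \<Longrightarrow> length gs = L"
  shows "real (card (set (queries f M (offline \<eta> k L G xs)))) \<le>
    1 + real (length xs) * (1 + 2 * real L * real (length G) * (log 2 (real k / \<eta>) + 1))"
proof -
  define R where "R = set (relevant_scales f \<eta> k xs)"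
  define q where "q s gs = set (queries f M (staged f M \<eta> k L xs s gs))" for s gs
  have q: "card (q s gs) \<le> 2 * L * length (candidates f M \<eta> k xs s)" if "gs \<in> set G" for s gs
  proof -
    have "card (q s gs) \<le> length (queries f M (staged f M \<eta> k L xs s gs))"
      unfolding q_def by (rule card_length)
    also have "\<dots> \<le> 2 * length gs * length (candidates f M \<eta> k xs s)"
      unfolding staged_def by (rule length_queries_stages)
    finally show ?thesis using G[OF that] by simp
  qed
  have "card (\<Union>gs\<in>set G. q s gs) \<le> length G * (2 * L * length (candidates f M \<eta> k xs s))" for s
  proof -
    have "card (\<Union>gs\<in>set G. q s gs) \<le> (\<Sum>gs\<in>set G. card (q s gs))" by (intro card_UN_le) simp
    also have "\<dots> \<le> card (set G) * (2 * L * length (candidates f M \<eta> k xs s))"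
      using sum_bounded_above[of "set G" "\<lambda>gs. card (q s gs)"] q by simp
    also have "\<dots> \<le> length G * (2 * L * length (candidates f M \<eta> k xs s))"
      by (intro mult_right_mono card_length) simp
    finally show ?thesis .
  qed
  then have "(\<Sum>s\<in>R. card (\<Union>gs\<in>set G. q s gs)) \<le>
      (\<Sum>s\<in>R. length G * (2 * L * length (candidates f M \<eta> k xs s)))"
    by (intro sum_mono)
  moreover have "card (\<Union>s\<in>R. \<Union>gs\<in>set G. q s gs) \<le> (\<Sum>s\<in>R. card (\<Union>gs\<in>set G. q s gs))"
    by (intro card_UN_le) (simp add: R_def)
  moreover have "(\<Sum>s\<in>R. length G * (2 * L * length (candidates f M \<eta> k xs s))) =
      2 * L * length G * (\<Sum>s\<in>R. length (candidates f M \<eta> k xs s))"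
    by (simp add: sum_distrib_left mult_ac)
  ultimately have "card (\<Union>s\<in>R. \<Union>gs\<in>set G. q s gs) \<le> 2 * L * length G * (\<Sum>s\<in>R. length (candidates f M \<eta> k xs s))"
    by linarith
  then have "real (card (\<Union>s\<in>R. \<Union>gs\<in>set G. q s gs)) \<le>
      real (2 * L * length G * (\<Sum>s\<in>R. length (candidates f M \<eta> k xs s)))" by (simp only: of_nat_le_iff)
  also have "\<dots> = 2 * real L * real (length G) * real (\<Sum>s\<in>R. length (candidates f M \<eta> k xs s))" by simp
  also have "\<dots> \<le> 2 * real L * real (length G) * (real (length xs) * (log 2 (real k / \<eta>) + 1))"
    by (intro mult_left_mono sum_length_candidates assms) (simp_all add: R_def)
  finally have U: "real (card (\<Union>s\<in>R. \<Union>gs\<in>set G. q s gs)) \<le>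
      2 * real L * real (length G) * (real (length xs) * (log 2 (real k / \<eta>) + 1))" .
  have "card (insert {} ((\<lambda>e. {e}) ` set xs)) \<le> 1 + length xs"
    using card_insert_le_m1[of "1 + length xs" "(\<lambda>e. {e}) ` set xs" "{}"] card_image_le[of "set xs" "\<lambda>e. {e}"]
      card_length[of xs] by simp
  then have "card (insert {} ((\<lambda>e. {e}) ` set xs) \<union> (\<Union>s\<in>R. \<Union>gs\<in>set G. q s gs)) \<le>
      1 + length xs + card (\<Union>s\<in>R. \<Union>gs\<in>set G. q s gs)"
    by (intro order_trans[OF card_Un_le]) simp
  then have "card (set (queries f M (offline \<eta> k L G xs))) \<le>
      1 + length xs + card (\<Union>s\<in>R. \<Union>gs\<in>set G. q s gs)"
    unfolding queries_offline R_def[symmetric] q_def .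
  then have "real (card (set (queries f M (offline \<eta> k L G xs)))) \<le>
      real (1 + length xs + card (\<Union>s\<in>R. \<Union>gs\<in>set G. q s gs))" by (simp only: of_nat_le_iff)
  then show ?thesis using U by (simp add: algebra_simps)
qed

section \<open>Feasibility and approximation ratio of the offline program\<close>

context matroid_submodular
begin

lemma card_le_rank: "S \<in> M \<Longrightarrow> card S \<le> matroid_rank M"
proof -
  have "finite M" using matroid finite_subset[of M "Pow V"] by (auto simp: matroid_def)
  then show "S \<in> M \<Longrightarrow> card S \<le> matroid_rank M" by (simp add: matroid_rank_def)
qed

lemma optimum_exists:
  assumes "finite U"
  obtains Z where "Z \<in> M" "Z \<subseteq> U" "f Z = Max (f ` {T \<in> M. T \<subseteq> U})"
proof -
  have "finite {T \<in> M. T \<subseteq> U}" using assms finite_subset[of _ "Pow U"] by auto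
  then have "Max (f ` {T \<in> M. T \<subseteq> U}) \<in> f ` {T \<in> M. T \<subseteq> U}"
    using empty_indep by (intro Max_in) auto
  then show ?thesis using that by force
qed

lemma outcomes_state:
  assumes "(S, y) \<in> set (outcomes f M \<eta> k L G xs)"
  shows "y = f S \<and> S \<in> M \<and> S \<subseteq> set xs"
proof -
  have "set (candidates f M \<eta> k xs s) \<subseteq> set xs" for s by (auto simp: candidates_def)
  then have "y = f S \<and> S \<in> M \<and> S \<subseteq> set xs"
    if "(S, y) = result f M (staged f M \<eta> k L xs s gs)" for s gs
    using stages_state[OF that[symmetric, unfolded staged_def] refl empty_indep] by blast
  then show ?thesis using assms empty_indep by (auto simp: outcomes_def)
qed

lemma outcome_le:
  assumes "(S, y) \<in> set (outcomes f M \<eta> k L G xs)"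
  shows "f S \<le> f (result f M (offline \<eta> k L G xs))"
  using best_correct(2)[OF assms, of f] outcomes_state by (auto simp: result_offline)

lemma offline_feasible:
  "result f M (offline \<eta> k L G xs) \<in> M \<and> result f M (offline \<eta> k L G xs) \<subseteq> set xs"
proof -
  have "({}, f {}) \<in> set (outcomes f M \<eta> k L G xs)" by (simp add: outcomes_def)
  then obtain y where "(best (outcomes f M \<eta> k L G xs), y) \<in> set (outcomes f M \<eta> k L G xs)"
    using best_correct(1)[of _ _ f] outcomes_state by blast
  from outcomes_state[OF this] show ?thesis by (simp add: result_offline)
qed

lemma queries_offline_subset:
  assumes "A \<in> set (queries f M (offline \<eta> k L G xs))"
  shows "A \<subseteq> set xs"
proof -
  have "A \<subseteq> set xs" if "A \<in> set (queries f M (staged f M \<eta> k L xs s gs))" for s gs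
  proof -
    obtain S y where "result f M (staged f M \<eta> k L xs s gs) = (S, y)" by fastforce
    from stages_state[OF this[unfolded staged_def] refl empty_indep] that
    have "A \<subseteq> set (candidates f M \<eta> k xs s)" unfolding staged_def by auto
    then show ?thesis by (auto simp: candidates_def)
  qed
  then show ?thesis using assms by (auto simp: queries_offline)
qed

lemma offline_rank_one:
  assumes "matroid_rank M = 1" "Z \<in> M" "Z \<subseteq> set xs"
  shows "f Z \<le> f (result f M (offline \<eta> k L G xs))"
proof -
  have "card Z \<le> 1" using card_le_rank assms by metis
  then have "Z = {} \<or> (\<exists>e. Z = {e})"
    using indep_finite[OF assms(2)] by (metis card_0_eq card_1_singletonE le_antisym less_one not_le)
  then have "(Z, f Z) \<in> set (outcomes f M \<eta> k L G xs)"
    using assms(2,3) by (auto simp: outcomes_def)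
  then show ?thesis by (rule outcome_le)
qed

text \<open>The power of two above the optimal gain serves as \<open>W\<close>;
  \<open>guess_exists\<close> is applied to the relevant part of an optimal \<open>Z\<close>. All
  estimates are made for gains over \<open>f {}\<close> first.\<close>

lemma offline_approx:
  assumes xs: "set xs \<subseteq> V" and k: "matroid_rank M = k" "k > 0" and \<eta>: "0 < \<eta>" "\<eta> \<le> 1 / 16"
    and L: "L > 0" "real k * (1 - \<eta>) ^ L \<le> \<eta>" and N: "real L / \<eta> < real N + 1"
    and Z: "Z \<in> M" "Z \<subseteq> set xs" and max: "\<And>T. T \<in> M \<Longrightarrow> T \<subseteq> set xs \<Longrightarrow> f T \<le> f Z"
  shows "(1 / 2 - 8 * \<eta>) * f Z \<le> f (result f M (offline \<eta> k L (guesses L N) xs))"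
proof -
  let ?b = "f (result f M (offline \<eta> k L (guesses L N) xs))"
  define w where "w = f Z - f {}"
  have "({}, f {}) \<in> set (outcomes f M \<eta> k L (guesses L N) xs)" by (simp add: outcomes_def)
  then have b0: "f {} \<le> ?b" by (rule outcome_le)
  have ZV: "Z \<subseteq> V" using Z(1) by (rule indep_subset)
  have "f {} \<ge> 0" by (rule f_nonneg) simp
  have "w \<ge> 0" using f_mono[OF _ ZV, of "{}"] by (simp add: w_def)
  have c: "0 \<le> 1 / 2 - 8 * \<eta>" "1 / 2 - 8 * \<eta> \<le> 1" using \<eta> by auto
  have main: "(1 / 2 - 8 * \<eta>) * w \<le> ?b - f {}"
  proof (cases "w = 0")
    case True
    then show ?thesis using b0 by simp
  next
    case False
    then have wpos: "w > 0" using \<open>w \<ge> 0\<close> by simp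
    define s where "s = \<lceil>log 2 w\<rceil>"
    define W :: real where "W = 2 powr s"
    have W: "w \<le> W" "W < 2 * w"
    proof -
      show "w \<le> W" unfolding W_def s_def using wpos by (subst log_le_iff[symmetric]) auto
      have "W < 2 powr (log 2 w + 1)" unfolding W_def s_def by (intro powr_less_mono) linarith+
      also have "\<dots> = 2 * w" using wpos by (simp add: powr_add)
      finally show "W < 2 * w" .
    qed
    have Wpos: "W > 0" using W wpos by linarith
    have single: "f {x} - f {} \<le> w" if "x \<in> Z" for x
      using f_mono[of "{x}" Z] ZV that by (simp add: w_def)
    define Opt where "Opt = {x \<in> Z. relevant \<eta> k s (f {x} - f {})}"
    have OptZ: "Opt \<subseteq> Z" by (auto simp: Opt_def)
    have OptM: "Opt \<in> M" using indep_down[OF Z(1) OptZ] .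
    have small: "f {x} - f {} \<le> \<eta> * W / k" if "x \<in> Z - Opt" for x
    proof -
      have "f {x} - f {} \<le> 2 powr s" using single[of x] that W(1) unfolding W_def by auto
      then have "real k * (f {x} - f {}) < \<eta> * W" using that by (auto simp: Opt_def relevant_def W_def)
      then show ?thesis using k(2) by (simp add: field_simps)
    qed
    have cardZ: "card Z \<le> k" using card_le_rank[OF Z(1)] k(1) by simp
    have fZ: "f Z \<le> f Opt + \<eta> * W"
    proof -
      have "f Z = f (Opt \<union> (Z - Opt))" using OptZ by (simp add: Un_absorb1)
      also have "\<dots> \<le> f Opt + (\<Sum>x\<in>Z - Opt. f (insert x Opt) - f Opt)"
        using ZV OptZ by (intro sum_marginals) auto
      also have "(\<Sum>x\<in>Z - Opt. f (insert x Opt) - f Opt) \<le> (\<Sum>x\<in>Z - Opt. \<eta> * W / k)"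
      proof (intro sum_mono)
        fix x assume x: "x \<in> Z - Opt"
        have "f (insert x Opt) - f Opt \<le> f {x} - f {}"
          using diminishing[of "{}" Opt x] OptZ ZV x by auto
        then show "f (insert x Opt) - f Opt \<le> \<eta> * W / k" using small[OF x] by linarith
      qed
      also have "\<dots> = card (Z - Opt) * (\<eta> * W / k)" by simp
      also have "\<dots> \<le> k * (\<eta> * W / k)"
      proof (intro mult_right_mono)
        have "card (Z - Opt) \<le> card Z" using indep_finite[OF Z(1)] by (intro card_mono) auto
        then show "real (card (Z - Opt)) \<le> real k" using cardZ by simp
      qed (use \<eta> Wpos in simp)
      also have "\<dots> = \<eta> * W" using k(2) by simp
      finally show ?thesis by simp
    qed
    \<comment> \<open>A relevant element of \<open>Z\<close> is what puts the scale \<open>s\<close>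
      among those that the program tries.\<close>
    have "Opt \<noteq> {}"
    proof
      assume "Opt = {}"
      then have "w \<le> \<eta> * W" using fZ by (simp add: w_def)
      also have "\<dots> \<le> (1 / 16) * W" using \<eta> Wpos by (intro mult_right_mono) auto
      finally show False using W(2) wpos by linarith
    qed
    then obtain x where x: "x \<in> Z" "relevant \<eta> k s (f {x} - f {})" by (auto simp: Opt_def)
    then have s_in: "s \<in> set (relevant_scales f \<eta> k xs)"
      using Z(2) set_scales[OF \<eta>(1) k(2)] by (auto simp: relevant_scales_def)
    define ys where "ys = candidates f M \<eta> k xs s"
    have ys: "set ys \<subseteq> V" using xs by (auto simp: ys_def candidates_def)
    have Optys: "Opt \<subseteq> set ys"
      using Z(2) indep_down[OF Z(1)] by (auto simp: Opt_def ys_def candidates_def)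
    have cardOpt: "card Opt \<le> k" using card_le_rank[OF OptM] k(1) by simp
    have "\<eta> \<le> 1 / 2" using \<eta> by simp
    have "f {x} - f {} \<le> W" if "x \<in> Opt" for x using single[of x] that OptZ W(1) by auto
    from guess_exists[OF ys Optys OptM cardOpt \<eta>(1) \<open>\<eta> \<le> 1 / 2\<close> Wpos this L]
    obtain gs S where gs: "length gs = L" "result f M (stages \<eta> (\<eta> * W / real L) ys gs W {} (f {})) = (S, f S)"
      "S \<in> M" "S \<subseteq> set ys" "real (sum_list gs) * (\<eta> * W / real L) \<le> f S - f {}"
      "f Opt - f {} \<le> (f S - f {}) * (1 + 1 / (1 - \<eta>)) + 3 * \<eta> * W" by blast
    define F where "F = f S - f {}"
    have F0: "F \<ge> 0" using f_mono[OF _ indep_subset[OF gs(3)], of "{}"] by (simp add: F_def)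
    \<comment> \<open>As \<open>S\<close> is feasible, its gain is at most the optimal one and so at
      most \<open>W\<close>; in units of \<open>\<eta> * W / real L\<close> this is at most
      \<open>real L / \<eta>\<close>, and the guess is enumerated.\<close>
    have "F \<le> w" using max[OF gs(3)] gs(4) by (auto simp: F_def w_def ys_def candidates_def)
    then have "real (sum_list gs) * (\<eta> * W / real L) \<le> W" using gs(5) W(1) by (simp add: F_def)
    then have "real (sum_list gs) \<le> real L / \<eta>" using Wpos \<eta>(1) L(1) by (simp add: field_simps)
    then have "sum_list gs \<le> N" using N by linarith
    then have "gs \<in> set (guesses L N)" using gs(1) by (simp add: in_guesses)
    moreover have "result f M (staged f M \<eta> k L xs s gs) = (S, f S)"
      using gs(2) by (simp add: staged_def ys_def W_def)
    ultimately have "(S, f S) \<in> set (outcomes f M \<eta> k L (guesses L N) xs)"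
      using s_in by (force simp: outcomes_def)
    then have bS: "f S \<le> ?b" by (rule outcome_le)
    have "1 + 1 / (1 - \<eta>) \<le> 2 + 2 * \<eta>"
    proof -
      have "1 \<le> (1 + 2 * \<eta>) * (1 - \<eta>)" using \<eta> by (simp add: algebra_simps)
      then show ?thesis using \<eta> by (simp add: field_simps)
    qed
    then have "F * (1 + 1 / (1 - \<eta>)) \<le> F * (2 + 2 * \<eta>)" using F0 by (intro mult_left_mono)
    moreover have "\<eta> * W \<le> \<eta> * (2 * w)" using W(2) \<eta> by (intro mult_left_mono) auto
    \<comment> \<open>Three of the four error terms come from \<open>guess_exists\<close>, the
      fourth from the dropped elements; \<open>W < 2 * w\<close> turns them into
      \<open>8 * \<eta> * w\<close>.\<close>
    moreover have "w \<le> F * (1 + 1 / (1 - \<eta>)) + 4 * (\<eta> * W)"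
      using fZ gs(6) by (simp add: w_def F_def)
    ultimately have "w \<le> F * (2 + 2 * \<eta>) + 8 * \<eta> * w" by simp
    then have "(1 - 8 * \<eta>) * w \<le> F * (2 + 2 * \<eta>)" by (simp add: algebra_simps)
    moreover have "(1 / 2 - 8 * \<eta>) * (2 + 2 * \<eta>) * w \<le> (1 - 8 * \<eta>) * w"
    proof (intro mult_right_mono)
      have "(1 / 2 - 8 * \<eta>) * (2 + 2 * \<eta>) = 1 - 15 * \<eta> - 16 * (\<eta> * \<eta>)" by (simp add: algebra_simps)
      moreover have "\<eta> * \<eta> \<ge> 0" by simp
      ultimately show "(1 / 2 - 8 * \<eta>) * (2 + 2 * \<eta>) \<le> 1 - 8 * \<eta>" using \<eta>(1) by linarith
    qed (use wpos in simp)
    ultimately have "((1 / 2 - 8 * \<eta>) * w) * (2 + 2 * \<eta>) \<le> F * (2 + 2 * \<eta>)"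
      by (simp add: mult_ac)
    then have "(1 / 2 - 8 * \<eta>) * w \<le> F" by (rule mult_right_le_imp_le) (use \<eta> in simp)
    then show ?thesis using bS by (simp add: F_def)
  qed
  \<comment> \<open>The ratio passes from gains to values because it is at most 1 and
    \<open>f {}\<close> is nonnegative.\<close>
  have "(1 / 2 - 8 * \<eta>) * f Z = (1 / 2 - 8 * \<eta>) * w + (1 / 2 - 8 * \<eta>) * f {}"
    unfolding distrib_left[symmetric] by (simp add: w_def)
  also have "\<dots> \<le> (?b - f {}) + 1 * f {}"
    using main c \<open>f {} \<ge> 0\<close> by (intro add_mono mult_right_mono) auto
  finally show ?thesis by simp
qed

end

section \<open>From distinct offline queries to amortized online queries\<close>

context matroid_submodular
begin

lemma online_offline:
  fixes es :: "'a list"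
  assumes i: "i \<in> {1..length es}" and \<eta>: "\<eta> > 0" "real k \<ge> \<eta>"
    and G: "\<And>gs. gs \<in> set G \<Longrightarrow> length gs = L"
  defines "Alg \<equiv> memo_alg (offline \<eta> k L G) [] Map.empty Map.empty"
  shows "solution f M Alg es i = result f M (offline \<eta> k L G (take i es))"
    and "A \<in> set (round_queries f M Alg es i) \<Longrightarrow> A \<subseteq> ground es i"
    and "amortized_queries f M Alg es i \<le> 4 + 4 * real L * real (length G) * (log 2 (real k / \<eta>) + 1)"
proof -
  define Q where "Q = set (queries f M (offline \<eta> k L G (take i es)))"
  define c where "c = 2 * real L * real (length G) * (log 2 (real k / \<eta>) + 1)"
  have sub: "set (queries f M (offline \<eta> k L G (take j es))) \<subseteq> Q" if "j \<le> i" for j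
  proof -
    have "take i es = take j es @ drop j (take i es)"
      using that by (metis append_take_drop_id min.absorb1 take_take)
    then show ?thesis unfolding Q_def using queries_offline_append by metis
  qed
  have "finite Q" by (simp add: Q_def)
  note on = online_of_offline[where P = "offline \<eta> k L G", OF this i sub, folded Alg_def]
  show "solution f M Alg es i = result f M (offline \<eta> k L G (take i es))" using on(1) .
  show "A \<subseteq> ground es i" if "A \<in> set (round_queries f M Alg es i)"
    using on(2) that queries_offline_subset unfolding ground_def by blast
  have "real (card Q) \<le> 1 + real (length (take i es)) * (1 + c)"
    unfolding Q_def c_def by (rule card_queries_offline[OF \<eta> G])
  also have "length (take i es) = i" using i by simp
  also have "1 + real i * (1 + c) \<le> real i * (2 + c)" using i by (simp add: algebra_simps)
  finally have "2 * real (card Q) / real i \<le> 2 * (real i * (2 + c)) / real i"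
    by (intro divide_right_mono) auto
  also have "\<dots> = 4 + 2 * c" using i by simp
  finally show "amortized_queries f M Alg es i \<le> 4 + 4 * real L * real (length G) * (log 2 (real k / \<eta>) + 1)"
    using on(3) by (simp add: c_def)
qed

end

section \<open>Choice of parameters\<close>

text \<open>Here \<open>x\<close> is \<open>1 / \<eta>\<close>. The factor
  \<open>2 * x * (1 + log 2 x)\<close> bounds the number of stages divided by \<open>ln k\<close>,
  and \<open>2 + ln (1 + x)\<close> is the cost per stage in the exponent of
  \<open>e\<close>.\<close>

definition query_exponent :: "real \<Rightarrow> real" where
  "query_exponent x = 2 * x * (1 + log 2 x) * (2 + ln (1 + x))"

text \<open>Since \<open>1 - 1 / x \<le> exp (- (1 / x))\<close>, this many stages shrink the
  threshold by the factor \<open>real k * x\<close>.\<close>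

lemma stage_count_suffices:
  fixes x :: real
  assumes "x > 1" "k > 0" "real L \<ge> x * ln (real k * x)"
  shows "real k * (1 - 1 / x) ^ L \<le> 1 / x"
proof -
  have "(1 - 1 / x) ^ L \<le> exp (- (1 / x)) ^ L"
    using assms exp_ge_add_one_self[of "- (1 / x)"] by (intro power_mono) auto
  also have "\<dots> = exp (- (real L / x))" by (simp add: exp_of_nat_mult[symmetric])
  also have "\<dots> \<le> exp (- ln (real k * x))"
    using assms by (simp add: field_simps)
  also have "\<dots> = 1 / (real k * x)" using assms by (simp add: exp_minus inverse_eq_divide)
  finally have "real k * (1 - 1 / x) ^ L \<le> real k * (1 / (real k * x))" by (intro mult_left_mono) auto
  then show ?thesis using assms by simp
qed

lemma query_bound:
  fixes x :: real
  assumes x: "x \<ge> 16" and k: "k \<ge> 2"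
  defines "L \<equiv> nat \<lceil>x * ln (real k * x)\<rceil>"
  defines "N \<equiv> nat \<lfloor>real L * x\<rfloor>"
  shows "4 + 4 * real L * real (length (guesses L N)) * (log 2 (real k * x) + 1) \<le> 12 * real k powr query_exponent x"
proof -
  define u where "u = ln (real k * x)"
  define l where "l = ln (real k)"
  have ln2: "ln (2::real) \<ge> 1 / 2" using exp_half_le2 by (subst ln_ge_iff) auto
  have l: "l \<ge> ln 2" using k by (simp add: l_def)
  have "ln x \<ge> ln (2 ^ 4)" using x by simp
  also have "ln (2 ^ 4 :: real) = 4 * ln 2" by (subst ln_realpow) auto
  finally have lnx: "ln x \<ge> 2" using ln2 by linarith
  have u: "u = l + ln x" using x k by (simp add: u_def l_def ln_mult)
  have u2: "u \<ge> 2" using u l ln2 lnx by linarith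
  have xu: "2 * u \<le> x * u" using x u2 by (intro mult_right_mono) auto
  have L: "x * u \<le> real L" "real L \<le> 2 * (x * u)"
    using xu u2 unfolding L_def u_def[symmetric] by linarith+
  have B: "log 2 (real k * x) + 1 \<le> real L + 1"
  proof -
    have "log 2 (real k * x) = u / ln 2" by (simp add: log_def u_def)
    also have "\<dots> \<le> u / (1 / 2)" using ln2 u2 by (intro divide_left_mono) auto
    finally show ?thesis using L(1) xu by simp
  qed
  have guesses: "real (length (guesses L N)) \<le> exp (real L * ln (1 + x)) * exp (real L)"
  proof -
    have "real (length (guesses L N)) \<le> (1 + x) ^ L * (1 + 1 / x) ^ N"
      using x by (intro length_guesses) auto
    also have "(1 + x) ^ L = exp (real L * ln (1 + x))" using x by (simp add: exp_of_nat_mult)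
    also have "(1 + 1 / x) ^ N \<le> exp (1 / x) ^ N"
      using x exp_ge_add_one_self[of "1 / x"] by (intro power_mono) auto
    also have "\<dots> = exp (real N / x)" by (simp add: exp_of_nat_mult[symmetric])
    also have "\<dots> \<le> exp (real L)"
    proof -
      have "real N \<le> real L * x" unfolding N_def using x by simp
      then show ?thesis using x by (simp add: field_simps)
    qed
    finally show ?thesis by simp
  qed
  have "real L * (real L + 1) \<le> 2 * exp (real L)"
    using exp_lower_Taylor_quadratic[of "real L"] by (simp add: power2_eq_square algebra_simps)
  then have poly: "4 * (real L * (real L + 1)) \<le> 8 * exp (real L)" by simp
  have "4 * real L * real (length (guesses L N)) * (log 2 (real k * x) + 1) \<le>
      4 * real L * real (length (guesses L N)) * (real L + 1)"
    using B by (intro mult_left_mono) auto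
  also have "\<dots> = 4 * (real L * (real L + 1)) * real (length (guesses L N))" by simp
  also have "\<dots> \<le> 8 * exp (real L) * (exp (real L * ln (1 + x)) * exp (real L))"
    by (intro mult_mono poly guesses) simp_all
  \<comment> \<open>The summand 2 collects one \<open>exp (real L)\<close> for the polynomial
    factors and one for the factor \<open>(1 + 1 / x) ^ N\<close> in the number of guesses.\<close>
  also have "\<dots> = 8 * exp (real L * (2 + ln (1 + x)))"
    by (simp add: exp_add[symmetric] algebra_simps)
  finally have "4 + 4 * real L * real (length (guesses L N)) * (log 2 (real k * x) + 1) \<le>
      4 + 8 * exp (real L * (2 + ln (1 + x)))" by simp
  also have "\<dots> \<le> 12 * exp (real L * (2 + ln (1 + x)))"
    using x by simp
  also have "real L * (2 + ln (1 + x)) \<le> 2 * (x * u) * (2 + ln (1 + x))"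
    using L(2) x by (intro mult_right_mono) auto
  \<comment> \<open>Here \<open>k \<ge> 2\<close> enters: \<open>ln 2 \<le> l\<close> gives
    \<open>ln x \<le> log 2 x * l\<close>, so the dependence on \<open>x\<close> can be moved into
    the exponent of \<open>k\<close>.\<close>
  also have "2 * (x * u) * (2 + ln (1 + x)) \<le> 2 * (x * (l * (1 + log 2 x))) * (2 + ln (1 + x))"
  proof -
    have "ln x = log 2 x * ln 2" by (simp add: log_def)
    also have "\<dots> \<le> log 2 x * l" using l x by (intro mult_left_mono) auto
    finally have "u \<le> l * (1 + log 2 x)" by (simp add: u algebra_simps)
    then show ?thesis using x by (intro mult_right_mono mult_left_mono) auto
  qed
  also have "\<dots> = query_exponent x * l" by (simp add: query_exponent_def)
  also have "exp (query_exponent x * l) = real k powr query_exponent x"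
    using k by (simp add: powr_def l_def)
  finally show ?thesis by simp
qed

text \<open>For \<open>\<epsilon> < 1/8\<close> each of the two logarithmic factors is at most a
  constant times \<open>ln (1 / \<epsilon>)\<close>, so the power 2 of the logarithm suffices; 480
  is \<open>16 * 6 * 5\<close>.\<close>

lemma query_exponent_soft: "(\<lambda>\<epsilon>. query_exponent (8 / \<epsilon>)) \<in> soft_bigo (at_right 0) (\<lambda>\<epsilon>. 1 / \<epsilon>)"
proof -
  have "eventually (\<lambda>\<epsilon>::real. \<epsilon> \<in> {0<..<1/8}) (at_right 0)" by (rule eventually_at_right_real) simp
  then have "eventually (\<lambda>\<epsilon>::real. norm (query_exponent (8 / \<epsilon>)) \<le> 480 * norm (1 / \<epsilon> * ln (1 / \<epsilon>) ^ 2)) (at_right 0)"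
  proof eventually_elim
    case (elim \<epsilon>)
    define y where "y = 1 / \<epsilon>"
    define u where "u = ln y"
    have y: "y > 8" using elim by (simp add: y_def field_simps)
    have ln2: "ln (2::real) \<ge> 1 / 2" using exp_half_le2 by (subst ln_ge_iff) auto
    have "u \<ge> ln (2 ^ 3)" using y by (simp add: u_def)
    also have "ln (2 ^ 3 :: real) = 3 * ln 2" by (subst ln_realpow) auto
    finally have u: "u \<ge> 1" using ln2 by linarith
    have log: "0 \<le> 1 + log 2 (8 * y)" "1 + log 2 (8 * y) \<le> 6 * u"
    proof -
      have "log 2 (8 * y) = log 2 (2 ^ 3) + log 2 y" using y by (subst log_mult_pos[symmetric]) auto
      also have "log 2 (2 ^ 3 :: real) = 3" by (subst log_pow_cancel) auto
      also have "log 2 y = u / ln 2" by (simp add: log_def u_def)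
      finally have *: "log 2 (8 * y) = 3 + u / ln 2" .
      have "u / ln 2 \<le> u / (1 / 2)" using ln2 u by (intro divide_left_mono) auto
      then have "u / ln 2 \<le> 2 * u" by simp
      moreover have "u / ln 2 \<ge> 0" using u by simp
      ultimately show "0 \<le> 1 + log 2 (8 * y)" "1 + log 2 (8 * y) \<le> 6 * u" using * u by linarith+
    qed
    have ln: "0 \<le> 2 + ln (1 + 8 * y)" "2 + ln (1 + 8 * y) \<le> 5 * u"
    proof -
      have "8 * y \<le> y * y" "1 \<le> y * y" "2 * (y * y) \<le> y * (y * y)"
        using y mult_mono[of 1 y 1 y] by (auto intro!: mult_right_mono)
      then have "1 + 8 * y \<le> y ^ 3" by (simp add: power3_eq_cube)
      then have "ln (1 + 8 * y) \<le> ln (y ^ 3)" using y by (subst ln_le_cancel_iff) auto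
      also have "\<dots> = 3 * u" using y by (simp add: u_def ln_realpow)
      finally show "2 + ln (1 + 8 * y) \<le> 5 * u" using u by linarith
      show "0 \<le> 2 + ln (1 + 8 * y)" using y by simp
    qed
    have "query_exponent (8 * y) = 16 * y * ((1 + log 2 (8 * y)) * (2 + ln (1 + 8 * y)))"
      by (simp add: query_exponent_def)
    also have "\<dots> \<le> 16 * y * ((6 * u) * (5 * u))"
      using log ln y u by (intro mult_left_mono mult_mono) auto
    also have "\<dots> = 480 * (y * u ^ 2)" by (simp add: power2_eq_square)
    finally have "query_exponent (8 * y) \<le> 480 * (y * u ^ 2)" .
    moreover have "query_exponent (8 * y) \<ge> 0"
      unfolding query_exponent_def using log ln y by (intro mult_nonneg_nonneg) auto
    moreover have "8 / \<epsilon> = 8 * y" by (simp add: y_def)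
    ultimately show ?case using y by (simp add: y_def[symmetric] u_def[symmetric] abs_mult)
  qed
  then have "(\<lambda>\<epsilon>. query_exponent (8 / \<epsilon>)) \<in> O[at_right 0](\<lambda>\<epsilon>. 1 / \<epsilon> * ln (1 / \<epsilon>) ^ 2)"
    by (rule bigoI)
  then show ?thesis unfolding soft_bigo_def by blast
qed

section \<open>The online algorithm and its guarantees\<close>

definition good_output where
  "good_output Alg \<epsilon> k M f es i \<longleftrightarrow>
    solution f M Alg es i \<subseteq> ground es i \<and>
    solution f M Alg es i \<in> M \<and>
    approximate_solution (1/2 - \<epsilon>) f M (ground es i) (solution f M Alg es i) \<and>
    (\<forall>A\<in>set (round_queries f M Alg es i). A \<subseteq> ground es i) \<and>
    amortized_queries f M Alg es i \<le> 12 * real k powr query_exponent (8 / \<epsilon>)"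

lemma algorithm_exists:
  fixes \<epsilon> :: real
  assumes \<epsilon>: "\<epsilon> > 0"
  shows "\<exists>Alg. \<forall>(V :: 'a set) M f es i. matroid V M \<longrightarrow> matroid_rank M = k \<longrightarrow>
    nonneg_monotone_submodular V f \<longrightarrow> set es \<subseteq> V \<longrightarrow> i \<in> {1..length es} \<longrightarrow> good_output Alg \<epsilon> k M f es i"
\<comment> \<open>Here the empty set is output without any query. For \<open>k = 0\<close> this is
  forced, as \<open>0 powr _\<close> is 0 and leaves no query budget; for
  \<open>\<epsilon> \<ge> 1 / 2\<close> the required ratio is not positive.\<close>
proof (cases "k = 0 \<or> \<epsilon> \<ge> 1 / 2")
  case True
  define Alg :: "'a online_algorithm" where "Alg = memo_alg (\<lambda>_. Return {}) [] Map.empty Map.empty"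
  have "good_output Alg \<epsilon> k M f es i" if "matroid V M" "matroid_rank M = k" "nonneg_monotone_submodular V f"
    "set es \<subseteq> V" "i \<in> {1..length es}" for V :: "'a set" and M f es i
  proof -
    interpret matroid_submodular V M f using that by unfold_locales
    note on = online_of_offline[of "{}" i es f M "\<lambda>_. Return {}", folded Alg_def, OF _ that(5)]
    have sol: "solution f M Alg es i = {}" "round_queries f M Alg es i = []"
      "amortized_queries f M Alg es i \<le> 0"
      using on by auto
    obtain Z where Z: "Z \<in> M" "Z \<subseteq> ground es i" "f Z = Max (f ` {T \<in> M. T \<subseteq> ground es i})"
      by (rule optimum_exists[of "ground es i"]) (auto simp: ground_def)
    have f0: "f {} \<ge> 0" "f Z \<ge> 0" using indep_subset[OF Z(1)] by (auto intro: f_nonneg)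
    have "(1 / 2 - \<epsilon>) * f Z \<le> f {}"
    proof (cases "k = 0")
      case True
      then have "Z = {}" using card_le_rank[OF Z(1)] that(2) indep_finite[OF Z(1)] by simp
      then show ?thesis using f0 \<epsilon> mult_right_mono[of "1 / 2 - \<epsilon>" 1 "f {}"] by simp
    next
      case False
      then have "(1 / 2 - \<epsilon>) * f Z \<le> 0" using True f0 by (intro mult_nonpos_nonneg) auto
      then show ?thesis using f0 by linarith
    qed
    moreover have "amortized_queries f M Alg es i \<le> 12 * real k powr query_exponent (8 / \<epsilon>)"
      using sol(3) by (rule order_trans) simp
    ultimately show ?thesis using sol Z(3) empty_indep
      by (auto simp: approximate_solution_def good_output_def)
  qed
  then show ?thesis by blast
next
  case False
  define \<eta> where "\<eta> = \<epsilon> / 8"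
  define x where "x = 8 / \<epsilon>"
  define L where "L = (if k = 1 then 1 else nat \<lceil>x * ln (real k * x)\<rceil>)"
  define N where "N = nat \<lfloor>real L * x\<rfloor>"
  \<comment> \<open>For \<open>k = 1\<close> the bound is 12 for every \<open>\<epsilon>\<close>, so
    no guesses are affordable; the singletons alone are then optimal, and the value 1 of
    \<open>L\<close> is arbitrary.\<close>
  define G where "G = (if k = 1 then [] else guesses L N)"
  define Alg :: "'a online_algorithm" where "Alg = memo_alg (offline \<eta> k L G) [] Map.empty Map.empty"
  have k: "k \<ge> 1" using False by (cases k) auto
  have \<eta>: "0 < \<eta>" "\<eta> \<le> 1 / 16" "1 / x = \<eta>" "8 * \<eta> = \<epsilon>" "\<And>y. y / \<eta> = y * x"
    using \<epsilon> False by (auto simp: \<eta>_def x_def)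
  have k\<eta>: "real k \<ge> \<eta>" using k \<eta>(2) by linarith
  have x: "x \<ge> 16" using \<epsilon> False by (simp add: x_def field_simps)
  have G: "length gs = L" if "gs \<in> set G" for gs
    using that by (auto simp: G_def length_in_guesses split: if_splits)
  have bound: "4 + 4 * real L * real (length G) * (log 2 (real k / \<eta>) + 1) \<le> 12 * real k powr query_exponent x"
  proof (cases "k = 1")
    case True
    then show ?thesis by (simp add: G_def)
  next
    case False
    then show ?thesis using query_bound[OF x, of k] k by (simp add: G_def L_def N_def \<eta>(5))
  qed
  have "good_output Alg \<epsilon> k M f es i" if "matroid V M" "matroid_rank M = k" "nonneg_monotone_submodular V f"
    "set es \<subseteq> V" "i \<in> {1..length es}" for V :: "'a set" and M f es i
  proof -
    interpret matroid_submodular V M f using that by unfold_locales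
    have on: "solution f M Alg es i = result f M (offline \<eta> k L G (take i es))"
      "\<And>A. A \<in> set (round_queries f M Alg es i) \<Longrightarrow> A \<subseteq> ground es i"
      "amortized_queries f M Alg es i \<le> 4 + 4 * real L * real (length G) * (log 2 (real k / \<eta>) + 1)"
      unfolding Alg_def by (rule online_offline[OF that(5) \<eta>(1) k\<eta> G]; assumption)+
    obtain Z where Z: "Z \<in> M" "Z \<subseteq> ground es i" "f Z = Max (f ` {T \<in> M. T \<subseteq> ground es i})"
      by (rule optimum_exists[of "ground es i"]) (auto simp: ground_def)
    have max: "f T \<le> f Z" if "T \<in> M" "T \<subseteq> set (take i es)" for T
    proof -
      have "finite {T \<in> M. T \<subseteq> ground es i}"
        by (rule finite_subset[of _ "Pow (ground es i)"]) (auto simp: ground_def)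
      then show ?thesis unfolding Z(3) using that by (intro Max_ge) (auto simp: ground_def)
    qed
    have fZ: "f Z \<ge> 0" using indep_subset[OF Z(1)] by (rule f_nonneg)
    have "(1 / 2 - \<epsilon>) * f Z \<le> f (result f M (offline \<eta> k L G (take i es)))"
    proof (cases "k = 1")
      case True
      then have "f Z \<le> f (result f M (offline \<eta> k L G (take i es)))"
        using offline_rank_one[of Z "take i es"] that(2) Z by (simp add: ground_def)
      moreover have "(1 / 2 - \<epsilon>) * f Z \<le> 1 * f Z" using \<epsilon> fZ by (intro mult_right_mono) auto
      ultimately show ?thesis by linarith
    next
      case False
      have "k \<ge> 2" using False k by simp
      have L: "real L \<ge> x * ln (real k * x)" using False unfolding L_def by simp linarith
      have "x * ln (real k * x) > 0"
      proof -
        have "1 * 1 < real k * x" using x k by (intro mult_le_less_imp_less) auto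
        then show ?thesis using x by simp
      qed
      then have "L > 0" using L by (cases L) auto
      moreover have "real k * (1 - \<eta>) ^ L \<le> \<eta>"
        using stage_count_suffices[OF _ _ L] x k by (simp add: \<eta>(3)[symmetric])
      moreover have "real L / \<eta> < real N + 1" unfolding N_def \<eta>(5) by linarith
      moreover have "set (take i es) \<subseteq> V" using that(4) set_take_subset by fastforce
      ultimately have "(1 / 2 - 8 * \<eta>) * f Z \<le> f (result f M (offline \<eta> k L (guesses L N) (take i es)))"
        using k Z max that(2) \<eta>(1,2) by (intro offline_approx) (auto simp: ground_def)
      then show ?thesis using False by (simp add: G_def \<eta>(4))
    qed
    then have "approximate_solution (1 / 2 - \<epsilon>) f M (ground es i) (solution f M Alg es i)"
      unfolding approximate_solution_def on(1) Z(3)[symmetric] .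
    moreover have "amortized_queries f M Alg es i \<le> 12 * real k powr query_exponent (8 / \<epsilon>)"
      using on(3) bound by (simp add: x_def)
    ultimately show ?thesis
      using on(1,2) offline_feasible by (auto simp: ground_def good_output_def)
  qed
  then show ?thesis by blast
qed

theorem theorem6p2:
  shows "\<exists>(E :: real \<Rightarrow> real) (C :: real).
    E \<in> soft_bigo (at_right 0) (\<lambda>\<epsilon>. 1 / \<epsilon>) \<and>
    (\<forall>\<epsilon>>0. \<forall>k::nat. \<exists>Alg :: 'a online_algorithm.
      \<forall>(V :: 'a set) M f es.
        matroid V M \<and> matroid_rank M = k \<and> nonneg_monotone_submodular V f \<and> set es \<subseteq> V \<longrightarrow>
        (\<forall>i\<in>{1..length es}.
          solution f M Alg es i \<subseteq> ground es i \<and>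
          solution f M Alg es i \<in> M \<and>
          approximate_solution (1/2 - \<epsilon>) f M (ground es i) (solution f M Alg es i) \<and>
          (\<forall>A\<in>set (round_queries f M Alg es i). A \<subseteq> ground es i) \<and>
          amortized_queries f M Alg es i \<le> C * real k powr E \<epsilon>))"
proof (intro exI[of _ "\<lambda>\<epsilon>. query_exponent (8 / \<epsilon>)"] exI[of _ 12] conjI query_exponent_soft allI impI)
  fix \<epsilon> :: real and k :: nat
  assume "\<epsilon> > 0"
  from algorithm_exists[OF this, of k, where 'a = 'a] show "\<exists>Alg :: 'a online_algorithm. \<forall>(V :: 'a set) M f es.
      matroid V M \<and> matroid_rank M = k \<and> nonneg_monotone_submodular V f \<and> set es \<subseteq> V \<longrightarrow>
      (\<forall>i\<in>{1..length es}.
        solution f M Alg es i \<subseteq> ground es i \<and>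
        solution f M Alg es i \<in> M \<and>
        approximate_solution (1/2 - \<epsilon>) f M (ground es i) (solution f M Alg es i) \<and>
        (\<forall>A\<in>set (round_queries f M Alg es i). A \<subseteq> ground es i) \<and>
        amortized_queries f M Alg es i \<le> 12 * real k powr query_exponent (8 / \<epsilon>))"
    unfolding good_output_def by blast
qed

end
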